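(* Consider a finite sequence $\{\mathbf{X}_k\}$ of independent, random, Hermitian matrices of the same size, and assume that $$0 \leq \lambda_{\min}(\mathbf{X}_k) \quad\text{and}\quad \lambda_{\max}(\mathbf{X}_k) \leq L \quad\text{for each index } k.$$ Introduce the random matrix $\mathbf{Y} = \sum_k \mathbf{X}_k$. Suppose that $\mathbf{M}$ is a (deterministic) Hermitian matrix that is a semidefinite upper bound for the expectation $\mathbb{E}\,\mathbf{Y}$: $$\mathbf{M} \succcurlyeq \mathbb{E}\,\mathbf{Y} = \sum_k \mathbb{E}\,\mathbf{X}_k.$$ Define $d = \operatorname{intdim}(\mathbf{M})$ and $\mu_{\max} = \lambda_{\max}(\mathbf{M})$. Then, for $\theta > 0$, $$\mathbb{E}\,\lambda_{\max}(\mathbf{Y}) \leq \frac{e^{\theta} - 1}{\theta} \cdot \mu_{\max} + \frac{1}{\theta} \cdot L \log(2d).$$ Furthermore, $$\mathbb{P}\{ \lambda_{\max}(\mathbf{Y}) \geq (1+\varepsilon)\mu_{\max} \} \leq 2d \cdot \left[ \frac{e^{\varepsilon}}{(1+\varepsilon)^{1+\varepsilon}} \right]^{\mu_{\max}/L} \quad\text{for } \varepsilon \geq L/\mu_{\max}.$$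
   Context: For a Hermitian matrix, $\lambda_{\min}$ and $\lambda_{\max}$ denote the algebraically smallest and largest eigenvalues. $\mathbf{M} \succcurlyeq \mathbf{A}$ means that $\mathbf{M} - \mathbf{A}$ is positive semidefinite. For a (nonzero) positive-semidefinite matrix $\mathbf{A}$, the intrinsic dimension is $\operatorname{intdim}(\mathbf{A}) = \operatorname{tr}(\mathbf{A}) / \|\mathbf{A}\|$, where $\|\cdot\|$ is the spectral norm. $\log$ is the natural logarithm. *)

theory Defs
  imports "HOL-Probability.Probability"
begin

definition conj_transpose :: "complex^'n^'m \<Rightarrow> complex^'m^'n" where
  "conj_transpose A = map_matrix cnj (transpose A)"

definition hermitian :: "complex^'n^'n \<Rightarrow> bool" where
  "hermitian A \<longleftrightarrow> conj_transpose A = A"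

definition is_eigenvalue :: "complex^'n^'n \<Rightarrow> complex \<Rightarrow> bool" where
  "is_eigenvalue A c \<longleftrightarrow> (\<exists>v. v \<noteq> 0 \<and> A *v v = c *s v)"

text \<open>The two extreme eigenvalues are meant for Hermitian matrices only: there the set of real
  eigenvalues is the full spectrum, and it is finite and nonempty.\<close>

definition lambda_min :: "complex^'n^'n \<Rightarrow> real" where
  "lambda_min A = Min {t::real. is_eigenvalue A (complex_of_real t)}"

definition lambda_max :: "complex^'n^'n \<Rightarrow> real" where
  "lambda_max A = Max {t::real. is_eigenvalue A (complex_of_real t)}"

text \<open>The sum below is \<open>v\<^sup>* A v\<close>, which is real for Hermitian \<open>A\<close>.\<close>

definition pos_semidef :: "complex^'n^'n \<Rightarrow> bool" where
  "pos_semidef A \<longleftrightarrow>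
     hermitian A \<and> (\<forall>v. 0 \<le> Re (\<Sum>i\<in>UNIV. cnj (v $ i) * (A *v v) $ i))"

definition loewner_le :: "complex^'n^'n \<Rightarrow> complex^'n^'n \<Rightarrow> bool" where
  "loewner_le A B \<longleftrightarrow> pos_semidef (B - A)"

text \<open>The norm on \<open>complex^'n\<close> is the Euclidean one, so the operator norm of the map
  \<open>v \<mapsto> A v\<close> is the spectral norm. (The library's \<open>norm A\<close> on matrices is the Frobenius norm.)\<close>

definition spectral_norm :: "complex^'n^'m \<Rightarrow> real" where
  "spectral_norm A = onorm (\<lambda>v. A *v v)"

text \<open>Meant for nonzero positive-semidefinite matrices, whose trace is real.\<close>

definition intdim :: "complex^'n^'n \<Rightarrow> real" where
  "intdim A = Re (trace A) / spectral_norm A"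

end

theory Submission
  imports Defs
begin

text \<open>
  Exponential moments reduce both bounds to one trace estimate. On positive semidefinite matrices
  \<open>exp (\<theta> * lambda_max Y) \<le> tr (exp (\<theta> Y)) - n + 1\<close>, where \<open>n\<close> is the size of the matrices, because the
  remaining eigenvalues contribute at least \<open>1\<close> each; so it suffices to bound the expectation of
  \<open>tr (exp (\<theta> Y))\<close>. The claim is that it is at most \<open>tr (exp (g M))\<close> for
  \<open>g = (exp (\<theta> L) - 1) / L\<close>. The intrinsic dimension \<open>d\<close> appears in the last step: the function
  \<open>exp (g x) - 1\<close> is convex and vanishes at \<open>0\<close>, hence lies below its chord on \<open>[0, \<mu>]\<close>, and
  summing over the eigenvalues gives \<open>tr (exp (g M)) - n \<le> d (exp (g \<mu>) - 1)\<close>.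

  The trace estimate needs a Jensen inequality which is a form of Lieb's concavity theorem: if
  \<open>E (exp X)\<close> is below \<open>exp W\<close> in the semidefinite order, then
  \<open>E (tr (exp (H + X))) \<le> tr (exp (H + W))\<close> for every fixed Hermitian \<open>H\<close>
  (\<open>expectation_rtr_mexp_le\<close>). By independence and Fubini it applies to one summand at a time, the
  other summands being absorbed into \<open>H\<close> (\<open>nn_integral_rtr_mexp_sum_le\<close>). For \<open>X = \<theta> X\<^sub>k\<close> one can take
  \<open>W = g (E X\<^sub>k)\<close>: on the spectrum \<open>exp (\<theta> x) \<le> 1 + g x\<close>, and \<open>1 + g (E X\<^sub>k)\<close> is below its exponential.

  The Jensen inequality rests on the Gibbs variational principle
  \<open>tr (exp (H + X)) = max\<^sub>T (tr (T H) + tr (exp X) - D (T, exp X))\<close>, with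
  \<open>D (T, A) = tr (T (log T - log A) - T + A)\<close> the quantum relative entropy, together with the joint
  convexity of \<open>D\<close>. Convexity is used in the form of a linear minorant touching \<open>D\<close> at a given pair
  (\<open>relent_support\<close>), which passes under the expectation. It is obtained from the scalar identity
  \<open>t (ln t - ln a) - t + a = \<integral>\<^sub>0\<^sup>1 (1 - u) (t - a)\<^sup>2 / ((1 - u) a + u t) du\<close>. In eigenbases of \<open>T\<close> and \<open>A\<close>
  it writes \<open>D\<close> as an integral of expressions of the form \<open>x\<^sup>2 / m\<close>, each of which is the maximum over
  \<open>z\<close> of \<open>2 x z - m z\<^sup>2\<close>; the corresponding matrix expressions are linear in \<open>(T, A)\<close>, and integrating
  the one that is optimal for the given pair produces the minorant.
\<close>

section \<open>Complex matrices, adjoints and the real trace\<close>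

abbreviation adjoint_matrix :: "complex^'n^'m \<Rightarrow> complex^'m^'n" ("_\<^sup>\<dagger>" [1000] 1000)
  where "A\<^sup>\<dagger> \<equiv> conj_transpose A"

text \<open>The real part of the trace is linear over the reals and invariant under cyclic rotation, and on
  Hermitian matrices it is the trace itself.\<close>

definition rtr :: "complex^'n^'n \<Rightarrow> real" where
  "rtr A = Re (trace A)"

definition diag :: "('n \<Rightarrow> real) \<Rightarrow> complex^'n^'n" where
  "diag f = (\<chi> i j. if i = j then complex_of_real (f i) else 0)"

definition unitary :: "complex^'n^'n \<Rightarrow> bool" where
  "unitary U \<longleftrightarrow> U\<^sup>\<dagger> ** U = mat 1"

definition unitary_diag :: "complex^'n^'n \<Rightarrow> ('n \<Rightarrow> real) \<Rightarrow> complex^'n^'n" where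
  "unitary_diag U f = U ** diag f ** U\<^sup>\<dagger>"

lemma bounded_bilinear_matrix_mult:
  "bounded_bilinear ((**) :: complex^'n^'m \<Rightarrow> complex^'p^'n \<Rightarrow> complex^'p^'m)"
proof -
  have "bilinear ((**) :: complex^'n^'m \<Rightarrow> complex^'p^'n \<Rightarrow> complex^'p^'m)"
    unfolding bilinear_def
    by (intro conjI allI linearI)
       (simp_all add: matrix_matrix_mult_def vec_eq_iff algebra_simps sum.distrib scaleR_sum_right)
  then show ?thesis by (simp add: bilinear_conv_bounded_bilinear)
qed

lemmas matrix_mult_bilinear =
  bounded_bilinear.add_left[OF bounded_bilinear_matrix_mult]
  bounded_bilinear.add_right[OF bounded_bilinear_matrix_mult]
  bounded_bilinear.diff_left[OF bounded_bilinear_matrix_mult]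
  bounded_bilinear.diff_right[OF bounded_bilinear_matrix_mult]
  bounded_bilinear.scaleR_left[OF bounded_bilinear_matrix_mult]
  bounded_bilinear.scaleR_right[OF bounded_bilinear_matrix_mult]
  bounded_bilinear.zero_left[OF bounded_bilinear_matrix_mult]
  bounded_bilinear.zero_right[OF bounded_bilinear_matrix_mult]

lemma conj_transpose_nth [simp]: "A\<^sup>\<dagger> $ i $ j = cnj (A $ j $ i)"
  by (simp add: conj_transpose_def transpose_def)

lemma bounded_linear_conj_transpose:
  "bounded_linear (conj_transpose :: complex^'n^'m \<Rightarrow> complex^'m^'n)"
  by (simp add: linear_conv_bounded_linear[symmetric] linear_iff vec_eq_iff)

lemmas conj_transpose_linear =
  linear_add[OF bounded_linear.linear[OF bounded_linear_conj_transpose]]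
  linear_diff[OF bounded_linear.linear[OF bounded_linear_conj_transpose]]
  linear_scale[OF bounded_linear.linear[OF bounded_linear_conj_transpose]]
  linear_0[OF bounded_linear.linear[OF bounded_linear_conj_transpose]]
  linear_sum[OF bounded_linear.linear[OF bounded_linear_conj_transpose]]

lemma bounded_linear_rtr: "bounded_linear (rtr :: complex^'n^'n \<Rightarrow> real)"
  by (simp add: linear_conv_bounded_linear[symmetric] linear_iff rtr_def trace_def sum.distrib
      sum_distrib_left)

lemmas rtr_linear =
  linear_add[OF bounded_linear.linear[OF bounded_linear_rtr]]
  linear_diff[OF bounded_linear.linear[OF bounded_linear_rtr]]
  linear_scale[OF bounded_linear.linear[OF bounded_linear_rtr]]
  linear_0[OF bounded_linear.linear[OF bounded_linear_rtr]]
  linear_sum[OF bounded_linear.linear[OF bounded_linear_rtr]]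

lemma conj_transpose_conj_transpose [simp]: "A\<^sup>\<dagger>\<^sup>\<dagger> = A"
  by (simp add: vec_eq_iff)

lemma conj_transpose_mult: "(A ** B)\<^sup>\<dagger> = B\<^sup>\<dagger> ** A\<^sup>\<dagger>"
  by (simp add: vec_eq_iff matrix_matrix_mult_def mult.commute)

lemma conj_transpose_diag [simp]: "(diag f)\<^sup>\<dagger> = diag f"
  by (auto simp: vec_eq_iff diag_def)

lemma rtr_mult_commute: "rtr (A ** B) = rtr (B ** A)"
  unfolding rtr_def by (subst trace_mul_sym) (rule refl)

lemma rtr_conj_transpose [simp]: "rtr (A\<^sup>\<dagger>) = rtr A"
  by (simp add: rtr_def trace_def)

lemma diag_mult_nth [simp]: "(diag f ** A) $ i $ j = of_real (f i) * A $ i $ j"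
proof -
  have "(diag f ** A) $ i $ j = (\<Sum>k\<in>UNIV. if k = i then of_real (f i) * A $ i $ j else 0)"
    unfolding matrix_matrix_mult_def diag_def vec_lambda_beta by (intro sum.cong) auto
  then show ?thesis by simp
qed

lemma mult_diag_nth [simp]: "(A ** diag f) $ i $ j = A $ i $ j * of_real (f j)"
proof -
  have "(A ** diag f) $ i $ j = (\<Sum>k\<in>UNIV. if k = j then A $ i $ j * of_real (f j) else 0)"
    unfolding matrix_matrix_mult_def diag_def vec_lambda_beta by (intro sum.cong) auto
  then show ?thesis by simp
qed

lemma diag_mult_vec_nth [simp]: "(diag f *v x) $ i = of_real (f i) * x $ i"
proof -
  have "(diag f *v x) $ i = (\<Sum>k\<in>UNIV. if k = i then of_real (f i) * x $ i else 0)"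
    unfolding matrix_vector_mult_def diag_def vec_lambda_beta by (intro sum.cong) auto
  then show ?thesis by simp
qed

lemma diag_nth: "diag f $ i $ j = (if i = j then complex_of_real (f i) else 0)"
  by (simp add: diag_def)

lemma diag_mult_diag: "diag f ** diag g = diag (\<lambda>i. f i * g i)"
proof -
  have "(diag f ** diag g) $ i $ j = diag (\<lambda>i. f i * g i) $ i $ j" for i j
    unfolding diag_mult_nth by (simp add: diag_nth)
  then show ?thesis unfolding vec_eq_iff by blast
qed

lemma diag_one: "diag (\<lambda>_. 1) = mat 1"
  unfolding diag_def mat_def of_real_1 ..

definition cinner :: "complex^'n \<Rightarrow> complex^'n \<Rightarrow> complex" where
  "cinner x y = (\<Sum>i\<in>UNIV. cnj (x $ i) * y $ i)"

lemma cinner_adjoint: "cinner x (A *v y) = cinner (A\<^sup>\<dagger> *v x) y"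
proof -
  have "cinner x (A *v y) = (\<Sum>i\<in>UNIV. \<Sum>j\<in>UNIV. cnj (x $ i) * A $ i $ j * y $ j)"
    by (simp add: cinner_def matrix_vector_mult_def sum_distrib_left mult.assoc)
  also have "\<dots> = (\<Sum>j\<in>UNIV. \<Sum>i\<in>UNIV. cnj (x $ i) * A $ i $ j * y $ j)"
    by (rule sum.swap)
  also have "\<dots> = cinner (A\<^sup>\<dagger> *v x) y"
    by (simp add: cinner_def matrix_vector_mult_def sum_distrib_right sum_distrib_left mult_ac)
  finally show ?thesis .
qed

lemma inner_complex_vec: "x \<bullet> y = Re (cinner x y)"
  by (simp add: cinner_def inner_vec_def inner_complex_def)

lemma inner_adjoint: "x \<bullet> (A *v y) = (A\<^sup>\<dagger> *v x) \<bullet> y"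
  by (simp add: inner_complex_vec cinner_adjoint)

lemma unitaryD:
  assumes "unitary U"
  shows "U\<^sup>\<dagger> ** U = mat 1" "U ** U\<^sup>\<dagger> = mat 1"
  using assms by (auto simp: unitary_def matrix_left_right_inverse)

lemma unitary_cancel:
  assumes "unitary U"
  shows "U\<^sup>\<dagger> ** (U ** A) = A" "U ** (U\<^sup>\<dagger> ** B) = B"
  using unitaryD[OF assms] by (simp_all add: matrix_mul_assoc)

lemma norm_unitary_vec:
  assumes "unitary U"
  shows "norm (U *v x) = norm x" "norm (U\<^sup>\<dagger> *v x) = norm x"
proof -
  have "(U *v x) \<bullet> (U *v x) = x \<bullet> x"
    by (simp add: inner_adjoint matrix_vector_mul_assoc unitaryD[OF assms])
  then show "norm (U *v x) = norm x" by (simp add: norm_eq_sqrt_inner)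
  have "(U\<^sup>\<dagger> *v x) \<bullet> (U\<^sup>\<dagger> *v x) = x \<bullet> x"
    by (simp add: inner_adjoint matrix_vector_mul_assoc unitaryD[OF assms])
  then show "norm (U\<^sup>\<dagger> *v x) = norm x" by (simp add: norm_eq_sqrt_inner)
qed

lemma unitary_diag_mult:
  assumes "unitary U"
  shows "unitary_diag U f ** unitary_diag U g = unitary_diag U (\<lambda>i. f i * g i)"
proof -
  have "unitary_diag U f ** unitary_diag U g = U ** (diag f ** ((U\<^sup>\<dagger> ** U) ** (diag g ** U\<^sup>\<dagger>)))"
    by (simp add: unitary_diag_def matrix_mul_assoc)
  also have "\<dots> = U ** (diag f ** diag g) ** U\<^sup>\<dagger>"
    by (simp add: unitaryD[OF assms] matrix_mul_assoc)
  finally show ?thesis by (simp add: diag_mult_diag unitary_diag_def)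
qed

lemma unitary_diag_one: "unitary U \<Longrightarrow> unitary_diag U (\<lambda>_. 1) = mat 1"
  by (simp add: unitary_diag_def diag_one unitaryD)

lemma diag_linear:
  "diag (\<lambda>i. f i + g i) = diag f + diag g" "diag (\<lambda>i. f i - g i) = diag f - diag g"
  "diag (\<lambda>i. c * f i) = c *\<^sub>R diag f"
  by (auto simp: diag_def vec_eq_iff complex_eq_iff)

lemma unitary_diag_linear:
  "unitary_diag U (\<lambda>i. f i + g i) = unitary_diag U f + unitary_diag U g" "unitary_diag U (\<lambda>i. f i - g i) = unitary_diag U f - unitary_diag U g"
  "unitary_diag U (\<lambda>i. c * f i) = c *\<^sub>R unitary_diag U f"
  by (simp_all add: unitary_diag_def diag_linear matrix_mult_bilinear)

lemma hermitian_unitary_diag: "hermitian (unitary_diag U f)"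
  by (simp add: hermitian_def unitary_diag_def conj_transpose_mult matrix_mul_assoc)

text \<open>The quadratic form \<open>v\<^sup>* A v\<close>: the real inner product of \<open>complex^'n\<close> is the real part of the
  Hermitian one.\<close>

definition quad :: "complex^'n^'n \<Rightarrow> complex^'n \<Rightarrow> real" where
  "quad A v = v \<bullet> (A *v v)"

lemma pos_semidef_iff_quad: "pos_semidef A \<longleftrightarrow> hermitian A \<and> (\<forall>v. 0 \<le> quad A v)"
  by (simp add: pos_semidef_def quad_def inner_vec_def inner_complex_def)

lemma quad_unitary_diag: "quad (unitary_diag U f) v = (\<Sum>i\<in>UNIV. f i * (cmod ((U\<^sup>\<dagger> *v v) $ i))\<^sup>2)"
proof -
  have "quad (unitary_diag U f) v = (U\<^sup>\<dagger> *v v) \<bullet> (diag f *v (U\<^sup>\<dagger> *v v))"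
    by (simp add: quad_def unitary_diag_def inner_adjoint matrix_vector_mul_assoc[symmetric])
  also have "\<dots> = (\<Sum>i\<in>UNIV. f i * (cmod ((U\<^sup>\<dagger> *v v) $ i))\<^sup>2)"
    by (simp add: inner_vec_def inner_complex_def cmod_power2)
       (simp add: power2_eq_square algebra_simps)
  finally show ?thesis .
qed

lemma cinner_scaleR: "cinner (c *\<^sub>R x) y = c *\<^sub>R cinner x y" "cinner x (c *\<^sub>R y) = c *\<^sub>R cinner x y"
  by (simp_all add: cinner_def scaleR_sum_right)

section \<open>The spectral theorem for Hermitian matrices\<close>

text \<open>Maximise the Rayleigh quotient over the unit sphere of the subspace. At a maximiser \<open>v\<close> with value
  \<open>c\<close> the form of \<open>c - A\<close> is nonnegative on the subspace and vanishes at \<open>v\<close>, so its first variation in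
  the direction \<open>w = c v - A v\<close>, which is \<open>2 (w \<bullet> w)\<close>, must vanish too. Working with real subspaces is
  harmless because the maximal value is real.\<close>

lemma eigenvector_in_invariant_subspace:
  fixes A :: "complex^'n^'n"
  assumes herm: "hermitian A" and S: "subspace S" and inv: "\<And>x. x \<in> S \<Longrightarrow> A *v x \<in> S"
    and ne: "\<exists>x\<in>S. x \<noteq> 0"
  obtains v c where "v \<in> S" "norm v = 1" "A *v v = c *\<^sub>R v"
proof -
  let ?K = "sphere 0 1 \<inter> S"
  have cont: "continuous_on UNIV (\<lambda>x::complex^'n. A *v x)"
    by (intro linear_continuous_on linear_conv_bounded_linear[THEN iffD1] matrix_vector_mul_linear)
  have "compact ?K"
    by (intro compact_Int_closed compact_sphere closed_subspace S)
  moreover have "?K \<noteq> {}"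
  proof -
    from ne obtain x where "x \<in> S" "x \<noteq> 0" by blast
    then have "(1 / norm x) *\<^sub>R x \<in> ?K" using S by (auto simp: subspace_scale)
    then show ?thesis by blast
  qed
  moreover have "continuous_on ?K (\<lambda>x. x \<bullet> (A *v x))"
    by (intro continuous_intros continuous_on_subset[OF cont]) auto
  ultimately obtain v where v: "v \<in> ?K" and max: "\<And>x. x \<in> ?K \<Longrightarrow> x \<bullet> (A *v x) \<le> v \<bullet> (A *v v)"
    using continuous_attains_sup[of ?K "\<lambda>x. x \<bullet> (A *v x)"] by blast
  define c where "c = v \<bullet> (A *v v)"
  define w where "w = c *\<^sub>R v - A *v v"
  define q where "q x = x \<bullet> (c *\<^sub>R x - A *v x)" for x
  have q_nonneg: "0 \<le> q x" if "x \<in> S" for x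
  proof (cases "x = 0")
    case False
    then have K: "(1 / norm x) *\<^sub>R x \<in> ?K" using S that by (auto simp: subspace_scale)
    from max[OF K] have "(x \<bullet> (A *v x)) / (norm x)\<^sup>2 \<le> c"
      by (simp add: c_def linear_scale[OF matrix_vector_mul_linear] power2_eq_square)
    with False show ?thesis
      by (simp add: q_def inner_diff_right dot_square_norm field_simps)
  qed (simp add: q_def)
  have sym: "x \<bullet> (A *v y) = (A *v x) \<bullet> y" for x y
    using herm by (simp add: inner_adjoint hermitian_def)
  have wS: "w \<in> S" using v S inv by (auto simp: w_def subspace_scale subspace_diff)
  have vv: "v \<bullet> v = 1" using v by (simp add: dot_square_norm)
  have qv: "q v = 0" by (simp add: q_def inner_diff_right c_def vv)
  have quad: "q (v + t *\<^sub>R w) = 2 * t * (w \<bullet> w) + t\<^sup>2 * q w" for t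
  proof -
    have "q (v + t *\<^sub>R w) = q v + t * (w \<bullet> (c *\<^sub>R v - A *v v)) + t * (v \<bullet> (c *\<^sub>R w - A *v w)) + t\<^sup>2 * q w"
      by (simp add: q_def algebra_simps linear_scale[OF matrix_vector_mul_linear] inner_add_left inner_add_right inner_diff_right
         power2_eq_square)
    also have "v \<bullet> (c *\<^sub>R w - A *v w) = c * (v \<bullet> w) - (A *v v) \<bullet> w"
      by (simp only: inner_diff_right sym inner_scaleR_right)
    also have "\<dots> = w \<bullet> w"
      by (simp only: w_def inner_diff_left inner_scaleR_left)
    finally show ?thesis by (simp add: qv w_def[symmetric])
  qed
  have "w \<bullet> w = 0"
  proof (rule ccontr)
    assume "w \<bullet> w \<noteq> 0"
    then have N: "w \<bullet> w > 0" by (simp add: less_le)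
    define Q where "Q = q w + 1"
    have Q: "Q > 0" "q w < Q" using q_nonneg[OF wS] by (auto simp: Q_def)
    \<comment> \<open>The minimiser of \<open>2 t (w \<bullet> w) + t\<^sup>2 Q\<close>; the \<open>1\<close> in \<open>Q\<close> avoids a division by zero.\<close>
    define t where "t = - (w \<bullet> w) / Q"
    have "0 \<le> q (v + t *\<^sub>R w)"
      using v wS S by (intro q_nonneg) (auto simp: subspace_add subspace_scale)
    also have "\<dots> = 2 * t * (w \<bullet> w) + t\<^sup>2 * q w" by (rule quad)
    also have "\<dots> \<le> 2 * t * (w \<bullet> w) + t\<^sup>2 * Q"
      using Q by (intro add_left_mono mult_left_mono) auto
    also have "\<dots> = - (w \<bullet> w)\<^sup>2 / Q"
      using Q by (simp add: t_def power2_eq_square field_simps)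
    also have "\<dots> < 0" using N Q by simp
    finally show False by simp
  qed
  then have "A *v v = c *\<^sub>R v" by (simp add: w_def)
  with v show ?thesis by (intro that[of v c]) auto
qed

text \<open>Orthonormal eigenvectors are added one at a time: the orthogonal complement of those already found
  is invariant because \<open>A\<close> is Hermitian, so it contains a further eigenvector.\<close>

theorem hermitian_spectral:
  fixes A :: "complex^'n^'n"
  assumes herm: "hermitian A"
  obtains U f where "unitary U" "A = unitary_diag U f"
proof -
  define good where "good J v c \<longleftrightarrow> (\<forall>i\<in>J. A *v v i = c i *\<^sub>R v i) \<and>
      (\<forall>i\<in>J. \<forall>j\<in>J. cinner (v i) (v j) = (if i = j then 1 else 0))"
    for J :: "'n set" and v :: "'n \<Rightarrow> complex^'n" and c :: "'n \<Rightarrow> real"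
  have ex: "\<exists>v c. good J v c" for J
  proof (induction J rule: finite_induct[OF finite])
    case 1
    show ?case by (simp add: good_def)
  next
    case (2 j J)
    then obtain v c where g: "good J v c" by blast
    define S where "S = {x. \<forall>i\<in>J. cinner (v i) x = 0}"
    have sub: "subspace S"
      unfolding S_def subspace_def
      by (auto simp: cinner_def algebra_simps sum.distrib scaleR_sum_right[symmetric])
    have inv: "A *v x \<in> S" if "x \<in> S" for x
      using that g herm
      by (auto simp: S_def good_def cinner_adjoint hermitian_def cinner_scaleR)
    have ne: "\<exists>x\<in>S. x \<noteq> 0"
    proof -
      \<comment> \<open>Complex orthogonality to \<open>v i\<close> is real orthogonality to both \<open>v i\<close> and \<open>\<i> v i\<close>, and the real
        dimension of the space is \<open>2 * CARD('n)\<close>.\<close>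
      define R where "R = v ` J \<union> (\<lambda>i. \<i> *s v i) ` J"
      have "dim R \<le> card R" by (intro dim_le_card') (simp add: R_def)
      also have "\<dots> \<le> card (v ` J) + card ((\<lambda>i. \<i> *s v i) ` J)"
        unfolding R_def by (rule card_Un_le)
      also have "\<dots> \<le> card J + card J" by (intro add_mono card_image_le) auto
      also have "\<dots> < 2 * CARD('n)"
        using 2(2) psubset_card_mono[of UNIV J] by fastforce
      finally have "dim R < DIM(complex^'n)" by simp
      then obtain x where x: "x \<noteq> 0" "\<And>y. y \<in> span R \<Longrightarrow> orthogonal x y"
        using orthogonal_to_subspace_exists by blast
      have "cinner (v i) x = 0" if "i \<in> J" for i
      proof -
        have "v i \<bullet> x = 0" "(\<i> *s v i) \<bullet> x = 0"
          using x(2)[of "v i"] x(2)[of "\<i> *s v i"] that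
          by (auto simp: R_def span_base orthogonal_def inner_commute)
        moreover have "(\<i> *s v i) \<bullet> x = Im (cinner (v i) x)"
          by (simp add: inner_complex_vec cinner_def)
        ultimately show ?thesis by (simp add: inner_complex_vec complex_eq_iff)
      qed
      with x show ?thesis by (auto simp: S_def)
    qed
    obtain w d where w: "w \<in> S" "norm w = 1" "A *v w = d *\<^sub>R w"
      by (rule eigenvector_in_invariant_subspace[OF herm sub inv ne])
    have "cinner w (v i) = cnj (cinner (v i) w)" for i
      by (simp add: cinner_def mult.commute)
    moreover have "cinner w w = 1"
    proof -
      have "cinner w w = complex_of_real (w \<bullet> w)"
        by (simp add: complex_eq_iff inner_complex_vec cinner_def)
      with w(2) show ?thesis by (simp add: dot_square_norm)
    qed
    ultimately have "good (insert j J) (v(j := w)) (c(j := d))"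
      using g w 2(2) by (auto simp: good_def S_def)
    then show ?case by blast
  qed
  from ex[of UNIV] obtain v c where g: "good UNIV v c" by blast
  define U :: "complex^'n^'n" where "U = (\<chi> k i. v i $ k)"
  have "(U\<^sup>\<dagger> ** U) $ i $ j = cinner (v i) (v j)" for i j
    by (simp add: U_def cinner_def matrix_matrix_mult_def)
  then have U: "unitary U"
    using g by (simp add: unitary_def vec_eq_iff mat_def good_def)
  have "(A ** U) $ k $ i = (A *v v i) $ k" for k i
    by (simp add: U_def matrix_matrix_mult_def matrix_vector_mult_def)
  then have "A ** U = U ** diag c"
    using g by (simp add: vec_eq_iff good_def U_def scaleR_conv_of_real[where 'a=complex] mult.commute)
  then have "A ** U ** U\<^sup>\<dagger> = unitary_diag U c" by (simp add: unitary_diag_def)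
  then have "A = unitary_diag U c" using unitaryD[OF U] by (simp add: matrix_mul_assoc[symmetric])
  with U show ?thesis by (rule that)
qed

section \<open>The matrix exponential and positive semidefinite matrices\<close>

primrec mpow :: "complex^'n^'n \<Rightarrow> nat \<Rightarrow> complex^'n^'n" where
  "mpow A 0 = mat 1"
| "mpow A (Suc k) = A ** mpow A k"

text \<open>The power series makes measurability immediate; every algebraic property comes from
  \<open>mexp_unitary_diag\<close>.\<close>

definition mexp :: "complex^'n^'n \<Rightarrow> complex^'n^'n" where
  "mexp A = (\<Sum>k. (1 / fact k) *\<^sub>R mpow A k)"

lemma unitary_diag_nth: "unitary_diag U f $ i $ j = (\<Sum>k\<in>UNIV. U $ i $ k * of_real (f k) * cnj (U $ j $ k))"
proof -
  have "unitary_diag U f $ i $ j = (\<Sum>k\<in>UNIV. (U ** diag f) $ i $ k * U\<^sup>\<dagger> $ k $ j)"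
    unfolding unitary_diag_def matrix_matrix_mult_def[of "U ** diag f"] vec_lambda_beta ..
  then show ?thesis by simp
qed

lemma mpow_unitary_diag: "unitary U \<Longrightarrow> mpow (unitary_diag U f) k = unitary_diag U (\<lambda>i. f i ^ k)"
  by (induction k) (simp_all add: unitary_diag_one unitary_diag_mult)

lemma mexp_unitary_diag:
  assumes U: "unitary U"
  shows "mexp (unitary_diag U f) = unitary_diag U (\<lambda>i. exp (f i))"
proof -
  have "(\<lambda>n. \<Sum>k<n. (1 / fact k) *\<^sub>R mpow (unitary_diag U f) k) \<longlonglongrightarrow> unitary_diag U (\<lambda>i. exp (f i))"
  proof (intro vec_tendstoI)
    fix i j
    have "(\<lambda>n. \<Sum>l\<in>UNIV. U $ i $ l * of_real (\<Sum>k<n. f l ^ k /\<^sub>R fact k) * cnj (U $ j $ l))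
        \<longlonglongrightarrow> (\<Sum>l\<in>UNIV. U $ i $ l * of_real (exp (f l)) * cnj (U $ j $ l))"
      by (intro tendsto_intros exp_converges[unfolded sums_def])
    moreover have "(\<Sum>k<n. (1 / fact k) *\<^sub>R mpow (unitary_diag U f) k) $ i $ j
        = (\<Sum>l\<in>UNIV. U $ i $ l * of_real (\<Sum>k<n. f l ^ k /\<^sub>R fact k) * cnj (U $ j $ l))" for n
      unfolding mpow_unitary_diag[OF U]
      by (simp add: unitary_diag_nth sum_distrib_left sum_distrib_right scaleR_sum_right sum.swap[of _ UNIV])
         (intro sum.cong refl, simp add: scaleR_conv_of_real divide_simps)
    ultimately show "(\<lambda>n. (\<Sum>k<n. (1 / fact k) *\<^sub>R mpow (unitary_diag U f) k) $ i $ j)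
        \<longlonglongrightarrow> unitary_diag U (\<lambda>i. exp (f i)) $ i $ j"
      by (simp only: unitary_diag_nth)
  qed
  then show ?thesis unfolding mexp_def by (simp add: sums_def sums_unique[symmetric])
qed

lemma borel_measurable_mexp [measurable]: "mexp \<in> borel_measurable borel"
proof -
  have "continuous_on UNIV (\<lambda>A :: complex^'n^'n. mpow A k)" for k
    by (induction k) (auto intro!: bounded_bilinear.continuous_on[OF bounded_bilinear_matrix_mult]
        continuous_on_const continuous_on_id)
  then have [measurable]: "(\<lambda>A :: complex^'n^'n. mpow A k) \<in> borel_measurable borel" for k
    by (rule borel_measurable_continuous_onI)
  show ?thesis unfolding mexp_def[abs_def] by measurable
qed

lemma borel_measurable_rtr [measurable]: "rtr \<in> borel_measurable borel"
  by (intro borel_measurable_continuous_onI bounded_linear.continuous_on[OF bounded_linear_rtr]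
      continuous_on_id)

lemma rtr_adjoint_mult: "rtr (A\<^sup>\<dagger> ** B) = (\<Sum>i\<in>UNIV. \<Sum>j\<in>UNIV. Re (cnj (A $ i $ j) * B $ i $ j))"
proof -
  have "rtr (A\<^sup>\<dagger> ** B) = (\<Sum>j\<in>UNIV. \<Sum>i\<in>UNIV. Re (cnj (A $ i $ j) * B $ i $ j))"
    unfolding rtr_def trace_def matrix_matrix_mult_def by (simp del: times_complex.sel)
  then show ?thesis by (subst sum.swap) simp
qed

text \<open>Traces of products of two matrices given in different eigenbases \<open>U\<close> and \<open>V\<close> are instances of this
  expansion in the matrix entries relative to these bases.\<close>

lemma rtr_sandwich:
  "rtr (Z\<^sup>\<dagger> ** unitary_diag U f ** W ** unitary_diag V g) =
    (\<Sum>i\<in>UNIV. \<Sum>j\<in>UNIV. Re (cnj ((U\<^sup>\<dagger> ** Z ** V) $ i $ j) * (U\<^sup>\<dagger> ** W ** V) $ i $ j) * f i * g j)"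
proof -
  have "rtr (Z\<^sup>\<dagger> ** unitary_diag U f ** W ** unitary_diag V g)
      = rtr ((Z\<^sup>\<dagger> ** U ** diag f ** (U\<^sup>\<dagger> ** W ** V) ** diag g) ** V\<^sup>\<dagger>)"
    by (simp add: unitary_diag_def matrix_mul_assoc)
  also have "\<dots> = rtr (V\<^sup>\<dagger> ** (Z\<^sup>\<dagger> ** U ** diag f ** (U\<^sup>\<dagger> ** W ** V) ** diag g))"
    by (rule rtr_mult_commute)
  also have "\<dots> = rtr ((U\<^sup>\<dagger> ** Z ** V)\<^sup>\<dagger> ** (diag f ** ((U\<^sup>\<dagger> ** W ** V) ** diag g)))"
    by (simp add: conj_transpose_mult matrix_mul_assoc)
  also have "\<dots> = (\<Sum>i\<in>UNIV. \<Sum>j\<in>UNIV. Re (cnj ((U\<^sup>\<dagger> ** Z ** V) $ i $ j) * (U\<^sup>\<dagger> ** W ** V) $ i $ j) * f i * g j)"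
    unfolding rtr_adjoint_mult diag_mult_nth mult_diag_nth by (simp add: algebra_simps)
  finally show ?thesis .
qed

lemma conj_transpose_one [simp]: "(mat 1)\<^sup>\<dagger> = mat 1"
  by (auto simp: vec_eq_iff mat_def)

lemma rtr_unitary_diag_mult:
  "rtr (unitary_diag U f ** unitary_diag V g) = (\<Sum>i\<in>UNIV. \<Sum>j\<in>UNIV. (cmod ((U\<^sup>\<dagger> ** V) $ i $ j))\<^sup>2 * f i * g j)"
proof -
  have "Re (cnj z * z) = (cmod z)\<^sup>2" for z
    by (simp add: cmod_power2) (simp add: power2_eq_square)
  then show ?thesis using rtr_sandwich[of "mat 1" U f "mat 1" V g] by simp
qed

lemma rtr_unitary_diag:
  assumes "unitary U"
  shows "rtr (unitary_diag U f) = (\<Sum>i\<in>UNIV. f i)"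
proof -
  have "rtr (unitary_diag U f) = rtr ((U ** diag f) ** U\<^sup>\<dagger>)" by (simp add: unitary_diag_def)
  also have "\<dots> = rtr (U\<^sup>\<dagger> ** (U ** diag f))" by (rule rtr_mult_commute)
  also have "\<dots> = (\<Sum>i\<in>UNIV. f i)"
    by (simp add: unitary_cancel[OF assms] rtr_def trace_def diag_nth)
  finally show ?thesis .
qed

lemma quad_eigenvector:
  assumes "unitary U"
  shows "quad (unitary_diag U f) (U *v axis i 1) = f i"
proof -
  have "quad (unitary_diag U f) (U *v axis i 1) = (\<Sum>j\<in>UNIV. f j * (cmod (axis i 1 $ j))\<^sup>2)"
    by (simp add: quad_unitary_diag matrix_vector_mul_assoc unitaryD[OF assms])
  also have "\<dots> = (\<Sum>j\<in>UNIV. if j = i then f i else 0)"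
    by (intro sum.cong) (auto simp: axis_def)
  finally show ?thesis by simp
qed

lemma unitary_axis_nonzero: "unitary U \<Longrightarrow> U *v axis i 1 \<noteq> 0"
  using norm_unitary_vec(1)[of U "axis i 1"] by (auto simp: axis_eq_0_iff)

lemma pos_semidef_spectral:
  assumes "pos_semidef E"
  obtains V e where "unitary V" "E = unitary_diag V e" "\<forall>i. 0 \<le> e i"
proof -
  from assms obtain V e where V: "unitary V" "E = unitary_diag V e"
    using hermitian_spectral[of E] by (auto simp: pos_semidef_iff_quad)
  have "0 \<le> e i" for i
    using assms quad_eigenvector[OF V(1), of e i] by (metis V(2) pos_semidef_iff_quad)
  then show ?thesis by (intro that[OF V]) simp
qed

lemma pos_semidef_unitary_diag: "(\<And>i. 0 \<le> f i) \<Longrightarrow> pos_semidef (unitary_diag U f)"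
  by (auto simp: pos_semidef_iff_quad hermitian_unitary_diag quad_unitary_diag intro!: sum_nonneg)

lemma rtr_sandwich_nonneg:
  assumes "pos_semidef E"
  shows "0 \<le> rtr (G\<^sup>\<dagger> ** G ** E)"
proof -
  from assms obtain V e where V: "unitary V" "E = unitary_diag V e" "\<forall>i. 0 \<le> e i"
    by (rule pos_semidef_spectral)
  have one: "unitary (mat 1 :: complex^'n^'n)"
    by (simp add: unitary_def)
  have re: "Re (cnj z * z) = (cmod z)\<^sup>2" for z
    by (simp add: cmod_power2) (simp add: power2_eq_square)
  have "rtr (G\<^sup>\<dagger> ** G ** E) = rtr (G\<^sup>\<dagger> ** unitary_diag (mat 1) (\<lambda>_. 1) ** G ** unitary_diag V e)"
    by (simp add: V unitary_diag_one[OF one])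
  then show ?thesis unfolding rtr_sandwich re using V(3) by (simp add: sum_nonneg)
qed

lemma rtr_mult_nonneg:
  assumes "pos_semidef E" "pos_semidef F"
  shows "0 \<le> rtr (E ** F)"
proof -
  from assms(1) obtain U e where U: "unitary U" "E = unitary_diag U e" "\<forall>i. 0 \<le> e i"
    by (rule pos_semidef_spectral)
  from assms(2) obtain V f where V: "unitary V" "F = unitary_diag V f" "\<forall>i. 0 \<le> f i"
    by (rule pos_semidef_spectral)
  show ?thesis unfolding U(2) V(2) rtr_unitary_diag_mult using U(3) V(3) by (simp add: sum_nonneg)
qed

lemma rtr_nonneg: "pos_semidef E \<Longrightarrow> 0 \<le> rtr E"
  using rtr_sandwich_nonneg[of E "mat 1"] by simp

lemma norm_unitary_nth_le_one:
  assumes "unitary U"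
  shows "cmod (U $ i $ k) \<le> 1"
proof -
  have "(U *v axis k 1) $ i = (\<Sum>j\<in>UNIV. if j = k then U $ i $ k else 0)"
    unfolding matrix_vector_mult_def axis_def vec_lambda_beta by (intro sum.cong) auto
  then have "cmod (U $ i $ k) \<le> norm (U *v axis k 1)"
    using Finite_Cartesian_Product.norm_nth_le[of "U *v axis k 1" i] by simp
  also have "\<dots> = 1"
    unfolding norm_unitary_vec[OF assms] by (simp add: norm_eq_sqrt_inner inner_axis_axis)
  finally show ?thesis .
qed

text \<open>A crude bound, whose only purpose is the integrability of matrices with bounded spectrum.\<close>

lemma norm_unitary_diag_le:
  assumes "unitary (U :: complex^'n^'n)"
  shows "norm (unitary_diag U f) \<le> (real CARD('n))\<^sup>2 * (\<Sum>k\<in>UNIV. \<bar>f k\<bar>)"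
proof -
  have "cmod (unitary_diag U f $ i $ j) \<le> (\<Sum>k\<in>UNIV. \<bar>f k\<bar>)" for i j
  proof -
    have "cmod (unitary_diag U f $ i $ j) \<le> (\<Sum>k\<in>UNIV. cmod (U $ i $ k) * \<bar>f k\<bar> * cmod (U $ j $ k))"
      unfolding unitary_diag_nth by (rule order_trans[OF norm_sum]) (simp add: norm_mult)
    also have "\<dots> \<le> (\<Sum>k\<in>UNIV. 1 * \<bar>f k\<bar> * 1)"
      by (intro sum_mono mult_mono norm_unitary_nth_le_one assms) auto
    finally show ?thesis by simp
  qed
  moreover have "norm (unitary_diag U f) \<le> (\<Sum>i\<in>UNIV. \<Sum>j\<in>UNIV. cmod (unitary_diag U f $ i $ j))"
    unfolding norm_vec_def by (intro order_trans[OF L2_set_le_sum] sum_mono) auto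
  ultimately have "norm (unitary_diag U f) \<le> (\<Sum>i\<in>(UNIV::'n set). \<Sum>j\<in>(UNIV::'n set). \<Sum>k\<in>UNIV. \<bar>f k\<bar>)"
    by (meson order_trans sum_mono)
  then show ?thesis by (simp add: power2_eq_square mult.assoc)
qed

section \<open>Quantum relative entropy and its linear minorants\<close>

text \<open>The relative entropy of \<open>exp R\<close> and \<open>exp S\<close>. Parametrising positive definite matrices by their
  logarithms means that no matrix logarithm has to be defined.\<close>

definition relent :: "complex^'n^'n \<Rightarrow> complex^'n^'n \<Rightarrow> real" where
  "relent R S = rtr (mexp R ** (R - S)) - rtr (mexp R) + rtr (mexp S)"

lemma relent_unitary_diag:
  assumes "unitary U" "unitary V"
  shows "relent (unitary_diag U r) (unitary_diag V s) = (\<Sum>i\<in>UNIV. \<Sum>j\<in>UNIV. (cmod ((U\<^sup>\<dagger> ** V) $ i $ j))\<^sup>2 *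
     (exp (r i) * (r i - s j) - exp (r i) + exp (s j)))"
proof -
  have U: "unitary_diag U f = unitary_diag U f ** unitary_diag V (\<lambda>_. 1)" for f by (simp add: unitary_diag_one assms)
  have V: "unitary_diag V f = unitary_diag U (\<lambda>_. 1) ** unitary_diag V f" for f by (simp add: unitary_diag_one assms)
  have "relent (unitary_diag U r) (unitary_diag V s) =
      rtr (unitary_diag U (\<lambda>i. exp (r i) * r i) ** unitary_diag V (\<lambda>_. 1)) - rtr (unitary_diag U (\<lambda>i. exp (r i)) ** unitary_diag V s)
      - rtr (unitary_diag U (\<lambda>i. exp (r i)) ** unitary_diag V (\<lambda>_. 1)) + rtr (unitary_diag U (\<lambda>_. 1) ** unitary_diag V (\<lambda>j. exp (s j)))"
    by (simp add: relent_def mexp_unitary_diag assms matrix_mult_bilinear rtr_linear unitary_diag_mult U[symmetric] V[symmetric])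
  also have "\<dots> = (\<Sum>i\<in>UNIV. \<Sum>j\<in>UNIV. (cmod ((U\<^sup>\<dagger> ** V) $ i $ j))\<^sup>2 *
     (exp (r i) * (r i - s j) - exp (r i) + exp (s j)))"
    unfolding rtr_unitary_diag_mult by (simp add: sum.distrib[symmetric] sum_subtractf[symmetric] algebra_simps)
  finally show ?thesis .
qed

text \<open>Klein's inequality. In eigenbases it reduces to the tangent line bound for the scalar exponential.\<close>

lemma relent_nonneg:
  assumes "hermitian R" "hermitian S"
  shows "0 \<le> relent R S"
proof -
  obtain U r where U: "unitary U" "R = unitary_diag U r" using hermitian_spectral[OF assms(1)] .
  obtain V s where V: "unitary V" "S = unitary_diag V s" using hermitian_spectral[OF assms(2)] .
  have "0 \<le> exp x * (x - y) - exp x + exp y" for x y :: real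
  proof -
    have "exp x * (1 + (y - x)) \<le> exp x * exp (y - x)"
      by (intro mult_left_mono exp_ge_add_one_self) auto
    then show ?thesis by (simp add: exp_diff algebra_simps)
  qed
  then show ?thesis unfolding U(2) V(2) relent_unitary_diag[OF U(1) V(1)] by (intro sum_nonneg) simp
qed

lemma hermitian_mexp: "hermitian A \<Longrightarrow> hermitian (mexp A)"
  by (metis hermitian_spectral mexp_unitary_diag hermitian_unitary_diag)

lemma pos_semidef_mexp: "hermitian A \<Longrightarrow> pos_semidef (mexp A)"
  by (metis hermitian_spectral mexp_unitary_diag pos_semidef_unitary_diag exp_ge_zero)

text \<open>The trace exponential is monotone although the matrix exponential itself is not: Klein's inequality
  bounds the difference of the traces below by \<open>tr (exp A (B - A))\<close>.\<close>

lemma rtr_mexp_mono: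
  assumes "hermitian A" "hermitian B" "pos_semidef (B - A)"
  shows "rtr (mexp A) \<le> rtr (mexp B)"
proof -
  have "0 \<le> rtr (mexp A ** (B - A))"
    by (intro rtr_mult_nonneg pos_semidef_mexp assms)
  with relent_nonneg[OF assms(1,2)] show ?thesis
    by (simp add: relent_def matrix_mult_bilinear rtr_linear)
qed

text \<open>Taylor's formula with integral remainder for \<open>t ln (t / a) - t + a\<close>, which vanishes to first order at
  \<open>t = a\<close>. The variable \<open>u\<close> runs along the segment from \<open>a\<close> to \<open>t\<close>.\<close>

lemma has_integral_relative_entropy:
  fixes t a :: real
  assumes "t > 0" "a > 0"
  shows "((\<lambda>u. (1 - u) * ((t - a)\<^sup>2 / (a + u * (t - a)))) has_integral
    t * (ln t - ln a) - t + a) {0..1}"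
proof -
  have pos: "a + u * (t - a) > 0" if "u \<in> {0..1}" for u
  proof -
    have "a + u * (t - a) = (1 - u) * a + u * t" by (simp add: algebra_simps)
    also have "\<dots> > 0"
      using that assms by (cases "u = 0") (auto intro: add_nonneg_pos)
    finally show ?thesis .
  qed
  \<comment> \<open>With \<open>m = a + u (t - a)\<close> one has \<open>(1 - u) (t - a) = t - m\<close>, so the integrand is the derivative of
    \<open>t ln m - m\<close>.\<close>
  define F where "F u = t * ln (a + u * (t - a)) - (a + u * (t - a))" for u
  have "((\<lambda>u. (1 - u) * ((t - a)\<^sup>2 / (a + u * (t - a)))) has_integral F 1 - F 0) {0..1}"
  proof (rule fundamental_theorem_of_calculus)
    fix u :: real assume u: "u \<in> {0..1}"
    have "(F has_real_derivative (1 - u) * ((t - a)\<^sup>2 / (a + u * (t - a)))) (at u within {0..1})"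
      unfolding F_def using pos[OF u]
      by (auto intro!: derivative_eq_intros simp: field_simps power2_eq_square)
    then show "(F has_vector_derivative (1 - u) * ((t - a)\<^sup>2 / (a + u * (t - a)))) (at u within {0..1})"
      by (simp add: has_real_derivative_iff_has_vector_derivative)
  qed simp
  then show ?thesis by (simp add: F_def algebra_simps)
qed

text \<open>The difference of the two sides is \<open>m\<close> times the squared modulus of \<open>z - (x / m) w\<close>.\<close>

lemma complete_square_bound:
  fixes m x :: real and z w :: complex
  assumes "m > 0"
  shows "2 * Re (cnj z * w) * x - m * (cmod z)\<^sup>2 \<le> (cmod w)\<^sup>2 * (x\<^sup>2 / m)"
    and "z = of_real (x / m) * w \<Longrightarrow> 2 * Re (cnj z * w) * x - m * (cmod z)\<^sup>2 = (cmod w)\<^sup>2 * (x\<^sup>2 / m)"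
proof -
  have *: "(cmod w)\<^sup>2 * (x\<^sup>2 / m) - (2 * Re (cnj z * w) * x - m * (cmod z)\<^sup>2) = m * (cmod (z - of_real (x / m) * w))\<^sup>2"
    using assms unfolding cmod_power2 by (simp add: field_simps power2_eq_square)
  have "0 \<le> m * (cmod (z - of_real (x / m) * w))\<^sup>2" using assms by simp
  with * show "2 * Re (cnj z * w) * x - m * (cmod z)\<^sup>2 \<le> (cmod w)\<^sup>2 * (x\<^sup>2 / m)" by linarith
  show "2 * Re (cnj z * w) * x - m * (cmod z)\<^sup>2 = (cmod w)\<^sup>2 * (x\<^sup>2 / m)"
    if "z = of_real (x / m) * w" using * that by simp
qed

text \<open>For fixed \<open>Z\<close> this is linear in \<open>(T, A)\<close>. When \<open>T\<close> and \<open>A\<close> are positive definite and \<open>0 \<le> u \<le> 1\<close>, its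
  maximum over \<open>Z\<close> is the quadratic form of \<open>T - A\<close> with respect to the inverse of the operator \<open>Z \<mapsto> (1 - u) Z A + u T Z\<close>.\<close>

definition linear_minorant ::
  "complex^'n^'n \<Rightarrow> real \<Rightarrow> complex^'n^'n \<Rightarrow> complex^'n^'n \<Rightarrow> real" where
  "linear_minorant Z u T A =
    2 * rtr (Z\<^sup>\<dagger> ** (T - A)) - (1 - u) * rtr (Z\<^sup>\<dagger> ** Z ** A) - u * rtr (Z\<^sup>\<dagger> ** T ** Z)"

lemma linear_minorant_unitary_diag:
  assumes U: "unitary U" and V: "unitary V"
  shows "linear_minorant Z u (unitary_diag U f) (unitary_diag V h) =
    (\<Sum>i\<in>UNIV. \<Sum>j\<in>UNIV. 2 * Re (cnj ((U\<^sup>\<dagger> ** Z ** V) $ i $ j) * (U\<^sup>\<dagger> ** V) $ i $ j) * (f i - h j)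
      - (h j + u * (f i - h j)) * (cmod ((U\<^sup>\<dagger> ** Z ** V) $ i $ j))\<^sup>2)"
proof -
  have re: "Re (cnj z * z) = (cmod z)\<^sup>2" for z
    by (simp add: cmod_power2) (simp add: power2_eq_square)
  note one = unitary_diag_one[OF U] unitary_diag_one[OF V]
  have *: "rtr (Z\<^sup>\<dagger> ** unitary_diag U f) = rtr (Z\<^sup>\<dagger> ** unitary_diag U f ** mat 1 ** unitary_diag V (\<lambda>_. 1))"
    "rtr (Z\<^sup>\<dagger> ** unitary_diag V h) = rtr (Z\<^sup>\<dagger> ** unitary_diag U (\<lambda>_. 1) ** mat 1 ** unitary_diag V h)"
    "rtr (Z\<^sup>\<dagger> ** Z ** unitary_diag V h) = rtr (Z\<^sup>\<dagger> ** unitary_diag U (\<lambda>_. 1) ** Z ** unitary_diag V h)"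
    "rtr (Z\<^sup>\<dagger> ** unitary_diag U f ** Z) = rtr (Z\<^sup>\<dagger> ** unitary_diag U f ** Z ** unitary_diag V (\<lambda>_. 1))"
    by (simp_all add: one)
  show ?thesis
    unfolding linear_minorant_def matrix_mult_bilinear rtr_linear * rtr_sandwich re
    by (simp add: sum_distrib_left sum.distrib[symmetric] sum_subtractf[symmetric] del: times_complex.sel)
       (simp add: algebra_simps del: times_complex.sel)
qed

text \<open>Joint convexity of the relative entropy, as a supporting hyperplane at the pair \<open>(exp R0, exp S0)\<close>;
  there is no constant term because the relative entropy is homogeneous. The last property says that
  \<open>tr - c\<close> is a monotone functional; it allows \<open>exp S0\<close> to be replaced by a smaller matrix later on.\<close>

lemma relent_support:
  fixes R0 S0 :: "complex^'n^'n"
  assumes herm: "hermitian R0" "hermitian S0"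
  obtains b c :: "complex^'n^'n \<Rightarrow> real" where "linear b" "linear c"
    "\<And>R S. hermitian R \<Longrightarrow> hermitian S \<Longrightarrow> b (mexp R) + c (mexp S) \<le> relent R S"
    "b (mexp R0) + c (mexp S0) = relent R0 S0"
    "\<And>E. pos_semidef E \<Longrightarrow> c E \<le> rtr E"
proof -
  obtain U0 r0 where U0: "unitary U0" "R0 = unitary_diag U0 r0" using hermitian_spectral[OF herm(1)] .
  obtain V0 s0 where V0: "unitary V0" "S0 = unitary_diag V0 s0" using hermitian_spectral[OF herm(2)] .
  define m where "m r s u = exp s + u * (exp r - exp s)" for r s u :: real
  have m_pos: "m r s u > 0" if "u \<in> {0..1}" for r s u
  proof -
    have "m r s u = (1 - u) * exp s + u * exp r" by (simp add: m_def algebra_simps)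
    also have "\<dots> > 0"
      using that by (cases "u = 0") (auto intro: add_nonneg_pos)
    finally show ?thesis .
  qed
  \<comment> \<open>The optimiser of \<open>linear_minorant\<close> at the base pair, entrywise in the two eigenbases.\<close>
  define z :: "real \<Rightarrow> complex^'n^'n"
    where "z u = (\<chi> i j. of_real ((exp (r0 i) - exp (s0 j)) / m (r0 i) (s0 j) u) * (U0\<^sup>\<dagger> ** V0) $ i $ j)" for u
  define Z where "Z u = U0 ** z u ** V0\<^sup>\<dagger>" for u
  have "continuous_on {0..1} z"
  proof -
    have "continuous_on {0..1} (m r s)" for r s
      unfolding m_def[abs_def] by (intro continuous_intros)
    moreover have "\<forall>u\<in>{0..1}. m r s u \<noteq> 0" for r s
      using m_pos less_irrefl by metis
    ultimately show ?thesis
      unfolding z_def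
      by (intro continuous_on_vec_lambda continuous_on_mult continuous_on_of_real
          continuous_on_divide continuous_on_const)
  qed
  then have cont_Z: "continuous_on {0..1} Z"
    unfolding Z_def
    by (intro bounded_bilinear.continuous_on[OF bounded_bilinear_matrix_mult] continuous_intros)
  note cont = bounded_linear.continuous_on[OF bounded_linear_rtr]
    bounded_linear.continuous_on[OF bounded_linear_conj_transpose]
    bounded_bilinear.continuous_on[OF bounded_bilinear_matrix_mult] cont_Z
  define b' where "b' T u = (1 - u) * (2 * rtr ((Z u)\<^sup>\<dagger> ** T) - u * rtr ((Z u)\<^sup>\<dagger> ** T ** Z u))" for T u
  define c' where "c' A u = - (1 - u) * (2 * rtr ((Z u)\<^sup>\<dagger> ** A) + (1 - u) * rtr ((Z u)\<^sup>\<dagger> ** Z u ** A))" for A u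
  define b where "b T = integral {0..1} (b' T)" for T
  define c where "c A = integral {0..1} (c' A)" for A
  have int_b: "b' T integrable_on {0..1}" for T
    unfolding b'_def by (intro integrable_continuous_real continuous_intros cont)
  have int_c: "c' T integrable_on {0..1}" for T
    unfolding c'_def by (intro integrable_continuous_real continuous_intros cont)
  have b'_lin: "b' (x + y) = (\<lambda>u. b' x u + b' y u)" "b' (k *\<^sub>R x) = (\<lambda>u. k * b' x u)" for x y k
    by (auto simp: b'_def fun_eq_iff matrix_mult_bilinear rtr_linear algebra_simps)
  have c'_lin: "c' (x + y) = (\<lambda>u. c' x u + c' y u)" "c' (k *\<^sub>R x) = (\<lambda>u. k * c' x u)" for x y k
    by (auto simp: c'_def fun_eq_iff matrix_mult_bilinear rtr_linear algebra_simps)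
  have lin: "linear b" "linear c"
    unfolding b_def c_def
    by (intro linearI; simp add: b'_lin c'_lin int_b int_c integral_add)+
  have bc: "((\<lambda>u. (1 - u) * linear_minorant (Z u) u T A) has_integral b T + c A) {0..1}" for T A
  proof -
    have "((\<lambda>u. b' T u + c' A u) has_integral b T + c A) {0..1}"
      unfolding b_def c_def by (intro has_integral_add integrable_integral int_b int_c)
    moreover have "b' T u + c' A u = (1 - u) * linear_minorant (Z u) u T A" for u
      by (simp add: b'_def c'_def linear_minorant_def matrix_mult_bilinear rtr_linear algebra_simps)
    ultimately show ?thesis by simp
  qed
  have D: "((\<lambda>u. (1 - u) * (\<Sum>i\<in>UNIV. \<Sum>j\<in>UNIV. (cmod ((U\<^sup>\<dagger> ** V) $ i $ j))\<^sup>2 *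
        ((exp (r i) - exp (s j))\<^sup>2 / m (r i) (s j) u))) has_integral relent (unitary_diag U r) (unitary_diag V s)) {0..1}"
    if "unitary U" "unitary V" for U V :: "complex^'n^'n" and r s
  proof -
    have "((\<lambda>u. \<Sum>i\<in>UNIV. \<Sum>j\<in>UNIV. (cmod ((U\<^sup>\<dagger> ** V) $ i $ j))\<^sup>2 *
        ((1 - u) * ((exp (r i) - exp (s j))\<^sup>2 / (exp (s j) + u * (exp (r i) - exp (s j))))))
      has_integral relent (unitary_diag U r) (unitary_diag V s)) {0..1}"
      unfolding relent_unitary_diag[OF that]
      using has_integral_relative_entropy[of "exp x" "exp y" for x y]
      by (intro has_integral_sum has_integral_mult_right) auto
    then show ?thesis
      by (simp add: m_def sum_distrib_left mult.left_commute)
  qed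
  have bound: "b (mexp R) + c (mexp S) \<le> relent R S" if herm': "hermitian R" "hermitian S" for R S
  proof -
    obtain U r where U: "unitary U" "R = unitary_diag U r" using hermitian_spectral[OF herm'(1)] .
    obtain V s where V: "unitary V" "S = unitary_diag V s" using hermitian_spectral[OF herm'(2)] .
    show ?thesis unfolding U(2) V(2) mexp_unitary_diag[OF U(1)] mexp_unitary_diag[OF V(1)]
    proof (rule has_integral_le[OF bc D[OF U(1) V(1)]])
      fix u :: real assume u: "u \<in> {0..1}"
      then show "(1 - u) * linear_minorant (Z u) u (unitary_diag U (\<lambda>i. exp (r i))) (unitary_diag V (\<lambda>i. exp (s i)))
         \<le> (1 - u) * (\<Sum>i\<in>UNIV. \<Sum>j\<in>UNIV. (cmod ((U\<^sup>\<dagger> ** V) $ i $ j))\<^sup>2 *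
             ((exp (r i) - exp (s j))\<^sup>2 / m (r i) (s j) u))"
        unfolding linear_minorant_unitary_diag[OF U(1) V(1)] m_def[symmetric]
        by (intro mult_left_mono sum_mono complete_square_bound m_pos) auto
    qed
  qed
  have eq: "b (mexp R0) + c (mexp S0) = relent R0 S0"
    unfolding U0(2) V0(2) mexp_unitary_diag[OF U0(1)] mexp_unitary_diag[OF V0(1)]
  proof (rule has_integral_unique[OF bc has_integral_eq[OF _ D[OF U0(1) V0(1)]]])
    fix u :: real assume u: "u \<in> {0..1}"
    have "U0\<^sup>\<dagger> ** Z u ** V0 = U0\<^sup>\<dagger> ** (U0 ** (z u ** (V0\<^sup>\<dagger> ** V0)))"
      by (simp add: Z_def matrix_mul_assoc)
    then have zu: "U0\<^sup>\<dagger> ** Z u ** V0 = z u"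
      by (simp add: unitary_cancel[OF U0(1)] unitaryD[OF V0(1)])
    show "(1 - u) * (\<Sum>i\<in>UNIV. \<Sum>j\<in>UNIV. (cmod ((U0\<^sup>\<dagger> ** V0) $ i $ j))\<^sup>2 *
             ((exp (r0 i) - exp (s0 j))\<^sup>2 / m (r0 i) (s0 j) u)) =
        (1 - u) * linear_minorant (Z u) u (unitary_diag U0 (\<lambda>i. exp (r0 i))) (unitary_diag V0 (\<lambda>i. exp (s0 i)))"
      unfolding linear_minorant_unitary_diag[OF U0(1) V0(1)] m_def[symmetric] zu
      by (intro arg_cong2[where f="(*)"] refl sum.cong complete_square_bound(2)[symmetric] m_pos[OF u])
         (simp add: z_def)
  qed
  have c_le: "c E \<le> rtr E" if E: "pos_semidef E" for E
  proof -
    have "((\<lambda>u. c' E u) has_integral c E) {0..1}"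
      unfolding c_def by (intro integrable_integral int_c)
    moreover have "((\<lambda>u::real. rtr E) has_integral rtr E) {0..1}"
      using has_integral_const_real[of "rtr E" 0 1] by simp
    moreover have "c' E u \<le> rtr E" for u
    proof -
      \<comment> \<open>\<open>rtr E - c' E u\<close> is a complete square.\<close>
      let ?G = "mat 1 + (1 - u) *\<^sub>R Z u"
      have hE: "E\<^sup>\<dagger> = E" using E by (simp add: pos_semidef_def hermitian_def)
      have "rtr (Z u ** E) = rtr ((Z u ** E)\<^sup>\<dagger>)" by simp
      also have "\<dots> = rtr ((Z u)\<^sup>\<dagger> ** E)"
        unfolding conj_transpose_mult hE by (rule rtr_mult_commute)
      finally have ZE: "rtr (Z u ** E) = rtr ((Z u)\<^sup>\<dagger> ** E)" .
      have "0 \<le> rtr (?G\<^sup>\<dagger> ** ?G ** E)" by (rule rtr_sandwich_nonneg[OF E])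
      also have "\<dots> = rtr E - c' E u"
        by (simp add: c'_def conj_transpose_linear matrix_mult_bilinear rtr_linear ZE)
           (simp add: algebra_simps)
      finally show ?thesis by simp
    qed
    ultimately show ?thesis by (rule has_integral_le)
  qed
  show ?thesis by (rule that[OF lin bound eq c_le])
qed

section \<open>Lieb's inequality for the expected trace exponential\<close>

lemma hermitian_add: "hermitian A \<Longrightarrow> hermitian B \<Longrightarrow> hermitian (A + B)"
  and hermitian_diff: "hermitian A \<Longrightarrow> hermitian B \<Longrightarrow> hermitian (A - B)"
  and hermitian_scaleR: "hermitian A \<Longrightarrow> hermitian (c *\<^sub>R A)"
  and hermitian_one: "hermitian (mat 1)"
  by (simp_all add: hermitian_def conj_transpose_linear)

lemma hermitian_zero: "hermitian 0"
  by (simp add: hermitian_def conj_transpose_linear)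

lemma hermitian_sum: "(\<And>k. k \<in> J \<Longrightarrow> hermitian (A k)) \<Longrightarrow> hermitian (\<Sum>k\<in>J. A k)"
  by (simp add: hermitian_def conj_transpose_linear)

lemma norm_mexp_le:
  fixes A :: "complex^'n^'n"
  assumes "hermitian A"
  shows "norm (mexp A) \<le> (real CARD('n))\<^sup>2 * rtr (mexp A)"
proof -
  obtain U f where U: "unitary U" "A = unitary_diag U f" using hermitian_spectral[OF assms] .
  show ?thesis
    using norm_unitary_diag_le[OF U(1), of "\<lambda>i. exp (f i)"] by (simp add: U(2) mexp_unitary_diag[OF U(1)] rtr_unitary_diag[OF U(1)])
qed

lemma linear_quad:
  fixes v :: "complex^'n"
  shows "linear (\<lambda>A. quad A v)"
proof (rule linearI)
  show "quad (A + B) v = quad A v + quad B v" for A B :: "complex^'n^'n"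
    by (simp add: quad_def matrix_vector_mult_add_rdistrib inner_add_right)
  have "(c *\<^sub>R A) *v v = c *\<^sub>R (A *v v)" for c and A :: "complex^'n^'n"
    by (simp add: vec_eq_iff matrix_vector_mult_def scaleR_sum_right)
  then show "quad (c *\<^sub>R A) v = c *\<^sub>R quad A v" for c and A :: "complex^'n^'n"
    by (simp add: quad_def)
qed

lemma quad_mexp_pos:
  assumes "hermitian A" "v \<noteq> 0"
  shows "0 < quad (mexp A) v"
proof -
  obtain U f where U: "unitary U" "A = unitary_diag U f" using hermitian_spectral[OF assms(1)] .
  have "norm (U\<^sup>\<dagger> *v v) \<noteq> 0" using assms(2) by (simp only: norm_unitary_vec[OF U(1)] norm_eq_zero) simp
  then obtain i where "(U\<^sup>\<dagger> *v v) $ i \<noteq> 0" by (auto simp: vec_eq_iff)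
  then show ?thesis
    unfolding U(2) mexp_unitary_diag[OF U(1)] quad_unitary_diag by (intro sum_pos2[of _ i]) auto
qed

text \<open>This supplies the logarithm of the expectation of a random matrix exponential.\<close>

lemma pos_definite_imp_mexp:
  assumes "hermitian A" "\<And>v. v \<noteq> 0 \<Longrightarrow> 0 < quad A v"
  obtains R where "hermitian R" "mexp R = A"
proof -
  obtain U f where U: "unitary U" "A = unitary_diag U f" using hermitian_spectral[OF assms(1)] .
  have "0 < f i" for i
    using assms(2)[OF unitary_axis_nonzero[OF U(1)]] by (simp add: U(2) quad_eigenvector[OF U(1)])
  then have "mexp (unitary_diag U (\<lambda>i. ln (f i))) = A" by (simp add: mexp_unitary_diag[OF U(1)] U(2))
  then show ?thesis by (rule that[OF hermitian_unitary_diag])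
qed

context prob_space
begin

lemma hermitian_expectation:
  assumes "integrable M X" "\<And>\<omega>. \<omega> \<in> space M \<Longrightarrow> hermitian (X \<omega>)"
  shows "hermitian (expectation X)"
proof -
  have "conj_transpose (expectation X) = expectation (\<lambda>\<omega>. conj_transpose (X \<omega>))"
    by (rule integral_bounded_linear[OF bounded_linear_conj_transpose assms(1), symmetric])
  also have "\<dots> = expectation X"
    using assms(2) by (intro Bochner_Integration.integral_cong) (auto simp: hermitian_def)
  finally show ?thesis by (simp add: hermitian_def)
qed

lemma integral_linear_matrix:
  fixes l :: "complex^'n^'n \<Rightarrow> real"
  assumes "linear l" "integrable M X"
  shows "integrable M (\<lambda>\<omega>. l (X \<omega>))" "expectation (\<lambda>\<omega>. l (X \<omega>)) = l (expectation X)"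
  using assms by (auto simp: linear_conv_bounded_linear intro: integrable_bounded_linear integral_bounded_linear)

lemma integrable_mexp:
  fixes X :: "'a \<Rightarrow> complex^'n^'n"
  assumes [measurable]: "X \<in> borel_measurable M"
    and herm: "\<And>\<omega>. \<omega> \<in> space M \<Longrightarrow> hermitian (X \<omega>)" "hermitian H"
    and bound: "AE \<omega> in M. pos_semidef (c *\<^sub>R mat 1 - X \<omega>)"
  shows "integrable M (\<lambda>\<omega>. mexp (H + X \<omega>))"
proof (rule integrable_const_bound)
  show "AE \<omega> in M. norm (mexp (H + X \<omega>)) \<le> (real CARD('n))\<^sup>2 * rtr (mexp (H + c *\<^sub>R mat 1))"
    using bound
  proof eventually_elim
    case (elim \<omega>)
    have "hermitian (X \<omega>)"
    proof -
      have "X \<omega> = c *\<^sub>R mat 1 - (c *\<^sub>R mat 1 - X \<omega>)" by simp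
      then show ?thesis
        using elim hermitian_diff[OF hermitian_scaleR[OF hermitian_one, of c]]
        by (metis pos_semidef_def)
    qed
    then have h: "hermitian (H + X \<omega>)" using herm by (intro hermitian_add)
    have "rtr (mexp (H + X \<omega>)) \<le> rtr (mexp (H + c *\<^sub>R mat 1))"
      using elim herm(2) by (intro rtr_mexp_mono h) (auto intro: hermitian_add hermitian_scaleR hermitian_one)
    then show ?case
      by (intro order_trans[OF norm_mexp_le[OF h]] mult_left_mono) auto
  qed
qed measurable

text \<open>With \<open>T = exp (H + X)\<close> and \<open>A = exp X\<close> the relative entropy of \<open>T\<close> and \<open>A\<close> equals
  \<open>tr (T H) - tr T + tr A\<close>. Bounding it below by the linear minorant at the pair \<open>(E T, exp W)\<close> gives an
  upper bound for \<open>tr T\<close> that is linear in \<open>(T, A)\<close>, so its expectation involves only \<open>E T\<close> and \<open>E A\<close>.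
  Replacing \<open>E A\<close> by the larger \<open>exp W\<close> and using that the minorant touches turns this into
  \<open>tr (E T (H + W - log (E T))) + tr (E T)\<close>, which Klein's inequality bounds by \<open>tr (exp (H + W))\<close>.\<close>

lemma expectation_rtr_mexp_le:
  fixes X :: "'a \<Rightarrow> complex^'n^'n"
  assumes meas: "X \<in> borel_measurable M"
    and herm: "\<And>\<omega>. \<omega> \<in> space M \<Longrightarrow> hermitian (X \<omega>)"
    and bound: "AE \<omega> in M. pos_semidef (c *\<^sub>R mat 1 - X \<omega>)"
    and H: "hermitian H" and W: "hermitian W"
    and dom: "pos_semidef (mexp W - expectation (\<lambda>\<omega>. mexp (X \<omega>)))"
  shows "expectation (\<lambda>\<omega>. rtr (mexp (H + X \<omega>))) \<le> rtr (mexp (H + W))"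
proof -
  define T where "T \<omega> = mexp (H + X \<omega>)" for \<omega>
  define A where "A \<omega> = mexp (X \<omega>)" for \<omega>
  have int_T: "integrable M T"
    unfolding T_def by (rule integrable_mexp[OF meas herm H bound])
  from integrable_mexp[OF meas herm hermitian_zero bound] have int_A: "integrable M A"
    by (simp add: A_def[abs_def])
  note lin_rtr = bounded_linear.linear[OF bounded_linear_rtr]
  have herm_T: "hermitian (T \<omega>)" if "\<omega> \<in> space M" for \<omega>
    unfolding T_def using that by (intro hermitian_mexp hermitian_add H herm)
  obtain R where R: "hermitian R" "mexp R = expectation T"
  proof (rule pos_definite_imp_mexp)
    show "hermitian (expectation T)" by (rule hermitian_expectation[OF int_T herm_T])
    fix v :: "complex^'n" assume v: "v \<noteq> 0"
    have "0 < expectation (\<lambda>\<omega>. quad (T \<omega>) v)"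
      using v by (intro expectation_greater integral_linear_matrix(1)[OF linear_quad int_T] AE_I2)
        (auto simp: T_def intro!: quad_mexp_pos hermitian_add H herm)
    then show "0 < quad (expectation T) v"
      by (simp add: integral_linear_matrix(2)[OF linear_quad int_T])
  qed
  obtain b d :: "complex^'n^'n \<Rightarrow> real" where b: "linear b" and d: "linear d"
    and le: "\<And>R S. hermitian R \<Longrightarrow> hermitian S \<Longrightarrow> b (mexp R) + d (mexp S) \<le> relent R S"
    and eq: "b (mexp R) + d (mexp W) = relent R W"
    and d_le: "\<And>E. pos_semidef E \<Longrightarrow> d E \<le> rtr E"
    using relent_support[OF R(1) W] by blast
  have lin_H: "linear (\<lambda>B. rtr (B ** H))"
    by (rule linearI) (simp_all add: matrix_mult_bilinear rtr_linear)
  have "expectation (\<lambda>\<omega>. rtr (T \<omega>)) \<le> expectation (\<lambda>\<omega>. rtr (T \<omega> ** H) + rtr (A \<omega>) - b (T \<omega>) - d (A \<omega>))"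
  proof (rule integral_mono)
    fix \<omega> assume \<omega>: "\<omega> \<in> space M"
    have "b (T \<omega>) + d (A \<omega>) \<le> relent (H + X \<omega>) (X \<omega>)"
      unfolding T_def A_def using \<omega> by (intro le hermitian_add H herm)
    then show "rtr (T \<omega>) \<le> rtr (T \<omega> ** H) + rtr (A \<omega>) - b (T \<omega>) - d (A \<omega>)"
      by (simp add: relent_def T_def A_def)
  qed (intro Bochner_Integration.integrable_add Bochner_Integration.integrable_diff
        integral_linear_matrix(1)[OF lin_rtr] integral_linear_matrix(1)[OF lin_H]
        integral_linear_matrix(1)[OF b] integral_linear_matrix(1)[OF d] int_T int_A)+
  also have "\<dots> = rtr (mexp R ** H) + rtr (expectation A) - b (mexp R) - d (expectation A)"
    using integral_linear_matrix[OF lin_rtr int_A] integral_linear_matrix[OF lin_H int_T]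
      integral_linear_matrix[OF b int_T] integral_linear_matrix[OF d int_A]
    by (simp add: R(2))
  also have "\<dots> \<le> rtr (mexp R ** H) + rtr (mexp W) - (b (mexp R) + d (mexp W))"
  proof -
    have "d (mexp W - expectation A) \<le> rtr (mexp W - expectation A)"
      using dom by (intro d_le) (simp add: A_def[abs_def])
    then show ?thesis by (simp add: linear_diff[OF d] rtr_linear)
  qed
  also have "\<dots> \<le> rtr (mexp (H + W))"
    using relent_nonneg[OF R(1) hermitian_add[OF H W]]
    unfolding eq by (simp add: relent_def matrix_mult_bilinear rtr_linear)
  finally show ?thesis by (simp add: T_def)
qed

section \<open>Trace exponentials of independent sums\<close>

lemma indep_var_sum_matrix:
  fixes X :: "'i \<Rightarrow> 'a \<Rightarrow> complex^'n^'n"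
  assumes I: "finite I" "i \<notin> I" and indep: "indep_vars (\<lambda>_. borel) X (insert i I)"
  shows "indep_var borel (X i) borel (\<lambda>\<omega>. \<Sum>i\<in>I. X i \<omega>)"
proof -
  have "indep_var
    borel ((\<lambda>f. f i) \<circ> (\<lambda>\<omega>. restrict (\<lambda>i. X i \<omega>) {i}))
    borel ((\<lambda>f. \<Sum>i\<in>I. f i) \<circ> (\<lambda>\<omega>. restrict (\<lambda>i. X i \<omega>) I))"
    using I by (intro indep_var_compose[OF indep_var_restrict[OF indep]] ) auto
  also have "((\<lambda>f. f i) \<circ> (\<lambda>\<omega>. restrict (\<lambda>i. X i \<omega>) {i})) = X i"
    by auto
  also have "((\<lambda>f. \<Sum>i\<in>I. f i) \<circ> (\<lambda>\<omega>. restrict (\<lambda>i. X i \<omega>) I)) = (\<lambda>\<omega>. \<Sum>i\<in>I. X i \<omega>)"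
    by (auto cong: rev_conj_cong)
  finally show ?thesis .
qed

text \<open>The statement is proved for all \<open>H\<close> at once: conditionally on the other summands, Lieb's inequality
  is applied with \<open>H\<close> shifted by their sum, after which the deterministic \<open>W j\<close> joins \<open>H\<close>. Nonnegative
  integrals make Fubini's theorem available without integrability of the trace.\<close>

lemma nn_integral_rtr_mexp_sum_le:
  fixes X :: "'i \<Rightarrow> 'a \<Rightarrow> complex^'n^'n"
  assumes fin: "finite J" and indep: "indep_vars (\<lambda>_. borel) X J"
    and herm: "\<And>k \<omega>. k \<in> J \<Longrightarrow> \<omega> \<in> space M \<Longrightarrow> hermitian (X k \<omega>)"
    and bound: "\<And>k. k \<in> J \<Longrightarrow> AE \<omega> in M. pos_semidef (c *\<^sub>R mat 1 - X k \<omega>)"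
    and W: "\<And>k. k \<in> J \<Longrightarrow> hermitian (W k)"
    and dom: "\<And>k. k \<in> J \<Longrightarrow> pos_semidef (mexp (W k) - expectation (\<lambda>\<omega>. mexp (X k \<omega>)))"
    and H: "hermitian H"
  shows "(\<integral>\<^sup>+\<omega>. ennreal (rtr (mexp (H + (\<Sum>k\<in>J. X k \<omega>)))) \<partial>M) \<le> ennreal (rtr (mexp (H + (\<Sum>k\<in>J. W k))))"
  using fin indep herm bound W dom H
proof (induction J arbitrary: H rule: finite_induct)
  case empty
  then show ?case by (simp add: emeasure_space_1)
next
  case (insert j J)
  define S where "S \<omega> = (\<Sum>k\<in>J. X k \<omega>)" for \<omega>
  have iv: "indep_var borel (X j) borel S"
    unfolding S_def[abs_def] by (rule indep_var_sum_matrix[OF insert.hyps insert.prems(1)])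
  have [measurable]: "X j \<in> borel_measurable M" "S \<in> borel_measurable M"
    using indep_var_rv1[OF iv] indep_var_rv2[OF iv] by auto
  interpret D1: prob_space "distr M borel (X j)" by (rule prob_space_distr) simp
  interpret D2: prob_space "distr M borel S" by (rule prob_space_distr) simp
  interpret D: pair_prob_space "distr M borel (X j)" "distr M borel S" ..
  define f where "f p = ennreal (rtr (mexp (H + snd p + fst p)))" for p :: "(complex^'n^'n) \<times> (complex^'n^'n)"
  have f_meas [measurable]: "f \<in> borel_measurable (borel \<Otimes>\<^sub>M borel)"
    unfolding f_def by measurable
  have herm_S: "hermitian (S \<omega>)" if "\<omega> \<in> space M" for \<omega>
    unfolding S_def using that insert.prems(2) by (intro hermitian_sum) auto
  have "(\<integral>\<^sup>+\<omega>. ennreal (rtr (mexp (H + (\<Sum>k\<in>insert j J. X k \<omega>)))) \<partial>M) = (\<integral>\<^sup>+\<omega>. f (X j \<omega>, S \<omega>) \<partial>M)"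
    using insert.hyps by (simp add: f_def S_def add_ac)
  also have "\<dots> = (\<integral>\<^sup>+p. f p \<partial>distr M (borel \<Otimes>\<^sub>M borel) (\<lambda>\<omega>. (X j \<omega>, S \<omega>)))"
    by (subst nn_integral_distr) auto
  also have "\<dots> = (\<integral>\<^sup>+p. f p \<partial>(distr M borel (X j) \<Otimes>\<^sub>M distr M borel S))"
    using iv by (simp add: indep_var_distribution_eq)
  also have "\<dots> = (\<integral>\<^sup>+s. (\<integral>\<^sup>+x. f (x, s) \<partial>distr M borel (X j)) \<partial>distr M borel S)"
    by (rule D.nn_integral_snd[symmetric]) simp
  also have "\<dots> = (\<integral>\<^sup>+\<omega>. (\<integral>\<^sup>+\<omega>'. f (X j \<omega>', S \<omega>) \<partial>M) \<partial>M)"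
    by (simp add: nn_integral_distr)
  also have "\<dots> \<le> (\<integral>\<^sup>+\<omega>. ennreal (rtr (mexp (H + W j + S \<omega>))) \<partial>M)"
  proof (rule nn_integral_mono)
    fix \<omega> assume \<omega>: "\<omega> \<in> space M"
    have HS: "hermitian (H + S \<omega>)" using insert.prems(6) herm_S[OF \<omega>] by (rule hermitian_add)
    have int: "integrable M (\<lambda>\<omega>'. mexp (H + S \<omega> + X j \<omega>'))"
      using insert.prems(2,3) HS by (intro integrable_mexp[where c=c]) auto
    have "(\<integral>\<^sup>+\<omega>'. f (X j \<omega>', S \<omega>) \<partial>M) = ennreal (expectation (\<lambda>\<omega>'. rtr (mexp (H + S \<omega> + X j \<omega>'))))"
      unfolding f_def fst_conv snd_conv
    proof (rule nn_integral_eq_integral)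
      show "integrable M (\<lambda>\<omega>'. rtr (mexp (H + S \<omega> + X j \<omega>')))"
        by (rule integral_linear_matrix(1)[OF bounded_linear.linear[OF bounded_linear_rtr] int])
      show "AE \<omega>' in M. 0 \<le> rtr (mexp (H + S \<omega> + X j \<omega>'))"
      proof (rule AE_I2)
        fix \<omega>' assume "\<omega>' \<in> space M"
        then have "pos_semidef (mexp (H + S \<omega> + X j \<omega>'))"
          using insert.prems(2) by (intro pos_semidef_mexp hermitian_add[OF HS]) auto
        then show "0 \<le> rtr (mexp (H + S \<omega> + X j \<omega>'))" by (rule rtr_nonneg)
      qed
    qed
    also have "\<dots> \<le> ennreal (rtr (mexp (H + S \<omega> + W j)))"
      using insert.prems HS by (intro ennreal_leI expectation_rtr_mexp_le[where c=c]) auto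
    finally show "(\<integral>\<^sup>+\<omega>'. f (X j \<omega>', S \<omega>) \<partial>M) \<le> ennreal (rtr (mexp (H + W j + S \<omega>)))"
      by (simp add: add_ac)
  qed
  also have "\<dots> \<le> ennreal (rtr (mexp (H + W j + (\<Sum>k\<in>J. W k))))"
    unfolding S_def using insert.prems
    by (intro insert.IH indep_vars_subset[OF insert.prems(1)] hermitian_add) auto
  finally show ?case using insert.hyps by (simp add: add_ac)
qed

end

section \<open>Extreme eigenvalues and the intrinsic dimension\<close>

lemma eigenvalues_unitary_diag:
  assumes U: "unitary U"
  shows "{t::real. is_eigenvalue (unitary_diag U f) (complex_of_real t)} = range f"
proof (intro equalityI subsetI)
  fix t assume "t \<in> {t::real. is_eigenvalue (unitary_diag U f) (complex_of_real t)}"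
  then obtain v where v: "v \<noteq> 0" "unitary_diag U f *v v = of_real t *s v"
    by (auto simp: is_eigenvalue_def)
  define w where "w = U\<^sup>\<dagger> *v v"
  have "norm w \<noteq> 0" using v(1) by (simp add: w_def norm_unitary_vec[OF U])
  then obtain i where i: "w $ i \<noteq> 0" by (auto simp: vec_eq_iff)
  have "U\<^sup>\<dagger> *v (unitary_diag U f *v v) = diag f *v w"
    by (simp add: w_def unitary_diag_def matrix_vector_mul_assoc matrix_mul_assoc unitaryD[OF U])
  moreover have "U\<^sup>\<dagger> *v (of_real t *s v) = of_real t *s w"
    by (simp add: w_def vector_scalar_commute)
  ultimately have "diag f *v w = of_real t *s w" using v(2) by simp
  then have "(diag f *v w) $ i = (of_real t *s w) $ i" by simp
  with i show "t \<in> range f" by auto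
next
  fix t assume "t \<in> range f"
  then obtain i where i: "t = f i" by blast
  have "diag f *v axis i 1 = of_real (f i) *s (axis i 1 :: complex^'a)"
    by (auto simp: vec_eq_iff axis_def)
  then have "unitary_diag U f *v (U *v axis i 1) = of_real t *s (U *v axis i 1)"
    by (simp add: i unitary_diag_def matrix_vector_mul_assoc matrix_mul_assoc[symmetric] unitaryD[OF U] vector_scalar_commute
       flip: matrix_vector_mul_assoc)
       (simp add: matrix_vector_mul_assoc unitaryD[OF U] vector_scalar_commute)
  moreover have "U *v axis i 1 \<noteq> 0"
    by (rule unitary_axis_nonzero[OF U])
  ultimately show "t \<in> {t::real. is_eigenvalue (unitary_diag U f) (complex_of_real t)}"
    by (auto simp: is_eigenvalue_def)
qed

lemma lambda_unitary_diag:
  assumes "unitary U"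
  shows "lambda_max (unitary_diag U f) = Max (range f)" "lambda_min (unitary_diag U f) = Min (range f)"
  by (simp_all add: lambda_max_def lambda_min_def eigenvalues_unitary_diag[OF assms])

lemma lambda_max_zero: "lambda_max (0 :: complex^'n^'n) = 0"
proof -
  have "unitary (mat 1 :: complex^'n^'n)" by (simp add: unitary_def)
  then have "lambda_max (unitary_diag (mat 1 :: complex^'n^'n) (\<lambda>_. 0)) = 0" by (simp add: lambda_unitary_diag)
  moreover have "unitary_diag (mat 1 :: complex^'n^'n) (\<lambda>_. 0) = 0" by (simp add: vec_eq_iff unitary_diag_nth)
  ultimately show ?thesis by simp
qed

lemma hermitian_spectral_bounded:
  assumes "hermitian A" "a \<le> lambda_min A" "lambda_max A \<le> b"
  obtains U f where "unitary U" "A = unitary_diag U f" "\<forall>i. a \<le> f i \<and> f i \<le> b"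
proof -
  obtain U f where U: "unitary U" "A = unitary_diag U f" using hermitian_spectral[OF assms(1)] .
  have "Min (range f) \<le> f i" "f i \<le> Max (range f)" for i by auto
  then have "\<forall>i. a \<le> f i \<and> f i \<le> b"
    using assms(2,3) by (auto simp: U(2) lambda_unitary_diag[OF U(1)] intro: order_trans)
  with U show ?thesis by (rule that)
qed

lemma one_plus_le_mexp:
  assumes "hermitian A"
  shows "pos_semidef (mexp A - (mat 1 + A))"
proof -
  obtain U f where U: "unitary U" "A = unitary_diag U f" using hermitian_spectral[OF assms] .
  have "mexp A - (mat 1 + A) = unitary_diag U (\<lambda>i. exp (f i) - (1 + f i))"
    by (simp add: U(2) mexp_unitary_diag[OF U(1)] unitary_diag_linear unitary_diag_one[OF U(1)])
  then show ?thesis by (simp add: pos_semidef_unitary_diag)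
qed

text \<open>Convexity of the exponential: on \<open>[0, L]\<close> it lies below its chord.\<close>

lemma exp_chord:
  fixes x L \<theta> :: real
  assumes "L > 0" "0 \<le> x" "x \<le> L"
  shows "exp (\<theta> * x) \<le> 1 + (exp (\<theta> * L) - 1) / L * x"
proof -
  have "exp ((1 - x / L) *\<^sub>R 0 + (x / L) *\<^sub>R (\<theta> * L)) \<le> (1 - x / L) * exp 0 + (x / L) * exp (\<theta> * L)"
    using assms by (intro convex_onD[OF exp_convex]) auto
  also have "(1 - x / L) *\<^sub>R 0 + (x / L) *\<^sub>R (\<theta> * L) = \<theta> * x"
    using assms by simp
  finally show ?thesis by (simp add: algebra_simps diff_divide_distrib)
qed

lemma mexp_chord:
  assumes "hermitian A" "0 \<le> lambda_min A" "lambda_max A \<le> L" "L > 0"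
  shows "pos_semidef (mat 1 + ((exp (\<theta> * L) - 1) / L) *\<^sub>R A - mexp (\<theta> *\<^sub>R A))"
proof -
  obtain U f where U: "unitary U" "A = unitary_diag U f" "\<forall>i. 0 \<le> f i \<and> f i \<le> L"
    by (rule hermitian_spectral_bounded[OF assms(1-3)])
  have "mat 1 + ((exp (\<theta> * L) - 1) / L) *\<^sub>R A - mexp (\<theta> *\<^sub>R A)
      = unitary_diag U (\<lambda>i. 1 + (exp (\<theta> * L) - 1) / L * f i - exp (\<theta> * f i))"
    by (simp add: U(2) mexp_unitary_diag[OF U(1)] unitary_diag_linear unitary_diag_one[OF U(1)] flip: unitary_diag_linear(3))
  moreover have "exp (\<theta> * f i) \<le> 1 + (exp (\<theta> * L) - 1) / L * f i" for i
    using U(3) assms(4) by (intro exp_chord) auto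
  ultimately show ?thesis by (simp only:) (intro pos_semidef_unitary_diag, simp)
qed

text \<open>The eigenvalues of \<open>A\<close> are nonnegative, so those of \<open>exp (\<theta> A)\<close> are at least \<open>1\<close>; subtracting the
  identity leaves a sum of nonnegative terms, one of which is \<open>exp (\<theta> lambda_max A) - 1\<close>.\<close>

lemma exp_lambda_max_le:
  fixes A :: "complex^'n^'n"
  assumes "pos_semidef A" "\<theta> > 0"
  shows "1 \<le> exp (\<theta> * lambda_max A)"
    and "exp (\<theta> * lambda_max A) \<le> rtr (mexp (\<theta> *\<^sub>R A)) - CARD('n) + 1"
proof -
  obtain U f where U: "unitary U" "A = unitary_diag U f" "\<forall>i. 0 \<le> f i"
    by (rule pos_semidef_spectral[OF assms(1)])
  have "Max (range f) \<in> range f" by (intro Max_in) auto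
  then obtain i where "Max (range f) = f i" by blast
  then have i: "lambda_max A = f i" by (simp add: U(2) lambda_unitary_diag[OF U(1)])
  show "1 \<le> exp (\<theta> * lambda_max A)" using U(3) assms(2) by (simp add: i)
  have "exp (\<theta> * f i) - 1 \<le> (\<Sum>j\<in>UNIV. exp (\<theta> * f j) - 1)"
    using U(3) assms(2) by (intro member_le_sum) auto
  also have "\<dots> = rtr (mexp (\<theta> *\<^sub>R A)) - CARD('n)"
    by (simp add: U(2) mexp_unitary_diag[OF U(1)] rtr_unitary_diag[OF U(1)] sum_subtractf flip: unitary_diag_linear(3))
  finally show "exp (\<theta> * lambda_max A) \<le> rtr (mexp (\<theta> *\<^sub>R A)) - CARD('n) + 1" by (simp add: i)
qed

text \<open>The third part is where the intrinsic dimension replaces the dimension: with \<open>\<mu>\<close> the largest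
  eigenvalue, the chord bound \<open>exp (g x) - 1 \<le> (x / \<mu>) (exp (g \<mu>) - 1)\<close> is summed over the spectrum, and
  the trace divided by \<open>\<mu>\<close> is at most \<open>intdim A\<close> since the spectral norm is at most \<open>\<mu>\<close>.\<close>

lemma pos_semidef_facts:
  fixes A :: "complex^'n^'n"
  assumes "pos_semidef A" "A \<noteq> 0"
  shows lambda_max_pos: "0 < lambda_max A"
    and intdim_ge_one: "1 \<le> intdim A"
    and rtr_mexp_le_intdim: "0 \<le> g \<Longrightarrow> rtr (mexp (g *\<^sub>R A)) \<le> CARD('n) + intdim A * (exp (g * lambda_max A) - 1)"
proof -
  obtain U f where U: "unitary U" "A = unitary_diag U f" "\<forall>i. 0 \<le> f i"
    by (rule pos_semidef_spectral[OF assms(1)])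
  define \<mu> where "\<mu> = lambda_max A"
  have \<mu>: "\<mu> = Max (range f)" by (simp add: \<mu>_def U(2) lambda_unitary_diag[OF U(1)])
  have f_le: "f i \<le> \<mu>" for i by (simp add: \<mu>)
  have "\<exists>i. f i \<noteq> 0"
  proof (rule ccontr)
    assume "\<not> ?thesis"
    then have "A = 0" by (simp add: U(2) vec_eq_iff unitary_diag_nth)
    with assms(2) show False ..
  qed
  then obtain i where "f i \<noteq> 0" by blast
  with U(3) have "0 < f i" by (simp add: less_le)
  then show \<mu>_pos: "0 < lambda_max A" using f_le[of i] by (simp add: \<mu>_def)
  then have \<mu>_pos: "\<mu> > 0" by (simp add: \<mu>_def)
  have norm_le: "norm (A *v x) \<le> \<mu> * norm x" for x
  proof -
    have "norm (A *v x) = norm (U *v (diag f *v (U\<^sup>\<dagger> *v x)))"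
      by (simp add: U(2) unitary_diag_def matrix_vector_mul_assoc matrix_mul_assoc)
    also have "\<dots> = norm (diag f *v (U\<^sup>\<dagger> *v x))" by (rule norm_unitary_vec[OF U(1)])
    also have "\<dots> \<le> norm (\<mu> *\<^sub>R (U\<^sup>\<dagger> *v x))"
      using U(3) f_le \<mu>_pos
      by (intro norm_le_componentwise_cart) (auto simp: norm_mult intro!: mult_right_mono)
    also have "\<dots> = \<mu> * norm x" using \<mu>_pos by (simp add: norm_unitary_vec[OF U(1)])
    finally show ?thesis .
  qed
  have "spectral_norm A \<le> \<mu>" unfolding spectral_norm_def by (rule onorm_le[OF norm_le])
  moreover have "0 < spectral_norm A"
  proof -
    have "bounded_linear ((*v) A)"
      by (simp add: linear_conv_bounded_linear[symmetric] matrix_vector_mul_linear)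
    moreover have "\<exists>x. A *v x \<noteq> 0" using assms(2) matrix_eq[of A 0] by auto
    ultimately show ?thesis
      unfolding spectral_norm_def by (subst onorm_pos_lt) auto
  qed
  moreover have "\<mu> \<le> rtr A"
  proof -
    have "Max (range f) \<in> range f" by (intro Max_in) auto
    then obtain i where "Max (range f) = f i" by blast
    then have "\<mu> = f i" by (simp add: \<mu>)
    moreover have "f i \<le> (\<Sum>j\<in>UNIV. f j)" using U(3) by (intro member_le_sum) auto
    ultimately show ?thesis by (simp add: U(2) rtr_unitary_diag[OF U(1)])
  qed
  ultimately have d_ge: "rtr A / \<mu> \<le> intdim A" and "1 \<le> rtr A / \<mu>"
    using \<mu>_pos by (auto simp: intdim_def rtr_def[symmetric] intro!: divide_left_mono)
  then show "1 \<le> intdim A" by linarith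
  show "rtr (mexp (g *\<^sub>R A)) \<le> CARD('n) + intdim A * (exp (g * lambda_max A) - 1)" if g: "0 \<le> g"
  proof -
    have "rtr (mexp (g *\<^sub>R A)) = (\<Sum>i\<in>UNIV. exp (g * f i))"
      by (simp add: U(2) mexp_unitary_diag[OF U(1)] rtr_unitary_diag[OF U(1)] flip: unitary_diag_linear(3))
    also have "\<dots> \<le> (\<Sum>i\<in>UNIV. 1 + (exp (g * \<mu>) - 1) / \<mu> * f i)"
      using U(3) f_le \<mu>_pos by (intro sum_mono exp_chord) auto
    also have "\<dots> = CARD('n) + rtr A / \<mu> * (exp (g * \<mu>) - 1)"
      by (simp add: sum.distrib U(2) rtr_unitary_diag[OF U(1)] sum_distrib_left[symmetric]
          sum_distrib_right[symmetric] sum_divide_distrib[symmetric])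
    also have "\<dots> \<le> CARD('n) + intdim A * (exp (g * \<mu>) - 1)"
      using d_ge g \<mu>_pos by (intro add_left_mono mult_right_mono) auto
    finally show ?thesis by (simp add: \<mu>_def)
  qed
qed

lemma pos_semidef_add: "pos_semidef A \<Longrightarrow> pos_semidef B \<Longrightarrow> pos_semidef (A + B)"
  by (auto simp: pos_semidef_iff_quad hermitian_add linear_add[OF linear_quad])

lemma pos_semidef_zero: "pos_semidef 0"
  by (simp add: pos_semidef_def hermitian_zero)

lemma pos_semidef_sum: "(\<And>k. k \<in> J \<Longrightarrow> pos_semidef (A k)) \<Longrightarrow> pos_semidef (\<Sum>k\<in>J. A k)"
  by (induction J rule: infinite_finite_induct) (auto simp: pos_semidef_zero intro: pos_semidef_add)

lemma pos_semidef_scaleR: "0 \<le> c \<Longrightarrow> pos_semidef A \<Longrightarrow> pos_semidef (c *\<^sub>R A)"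
  by (auto simp: pos_semidef_iff_quad hermitian_scaleR linear_scale[OF linear_quad])

lemma bounded_spectrum_consequences:
  fixes A :: "complex^'n^'n"
  assumes "hermitian A" "0 \<le> lambda_min A" "lambda_max A \<le> L"
  shows pos_semidef_of_lambda_min: "pos_semidef A"
    and pos_semidef_of_lambda_max: "pos_semidef (L *\<^sub>R mat 1 - A)"
    and norm_le_of_lambda: "norm A \<le> (real CARD('n))\<^sup>2 * (real CARD('n) * L)"
proof -
  obtain U f where U: "unitary U" "A = unitary_diag U f" "\<forall>i. 0 \<le> f i \<and> f i \<le> L"
    by (rule hermitian_spectral_bounded[OF assms])
  show "pos_semidef A" using U(3) by (simp add: U(2) pos_semidef_unitary_diag)
  have "L *\<^sub>R mat 1 - A = unitary_diag U (\<lambda>i. L * 1 - f i)"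
    unfolding unitary_diag_linear by (simp add: unitary_diag_one[OF U(1)] U(2))
  then show "pos_semidef (L *\<^sub>R mat 1 - A)" using U(3) by (simp add: pos_semidef_unitary_diag)
  have "(\<Sum>k\<in>UNIV. \<bar>f k\<bar>) \<le> (\<Sum>k\<in>(UNIV::'n set). L)" using U(3) by (intro sum_mono) auto
  then show "norm A \<le> (real CARD('n))\<^sup>2 * (real CARD('n) * L)"
    unfolding U(2) by (intro order_trans[OF norm_unitary_diag_le[OF U(1)]] mult_left_mono) auto
qed

context prob_space
begin

lemma pos_semidef_expectation:
  fixes X :: "'a \<Rightarrow> complex^'n^'n"
  assumes "integrable M X" "\<And>\<omega>. \<omega> \<in> space M \<Longrightarrow> hermitian (X \<omega>)" "AE \<omega> in M. pos_semidef (X \<omega>)"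
  shows "pos_semidef (expectation X)"
  unfolding pos_semidef_iff_quad
proof (intro conjI allI)
  show "hermitian (expectation X)" using assms(1,2) by (rule hermitian_expectation)
  fix v
  have "0 \<le> expectation (\<lambda>\<omega>. quad (X \<omega>) v)"
    using assms(3) by (intro integral_nonneg_AE) (auto simp: pos_semidef_iff_quad)
  then show "0 \<le> quad (expectation X) v"
    by (simp add: integral_linear_matrix(2)[OF linear_quad assms(1)])
qed

end

section \<open>The intrinsic Chernoff bounds\<close>

locale bounded_matrix_family = prob_space P for P :: "'a measure" +
  fixes I :: "'i set" and X :: "'i \<Rightarrow> 'a \<Rightarrow> complex^'n^'n" and L :: real
  assumes fin: "finite I"
    and indep: "indep_vars (\<lambda>_. borel) X I"
    and herm: "\<And>k \<omega>. k \<in> I \<Longrightarrow> \<omega> \<in> space P \<Longrightarrow> hermitian (X k \<omega>)"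
    and spectrum: "\<And>k. k \<in> I \<Longrightarrow> AE \<omega> in P. 0 \<le> lambda_min (X k \<omega>) \<and> lambda_max (X k \<omega>) \<le> L"
begin

definition Y :: "'a \<Rightarrow> complex^'n^'n" where "Y \<omega> = (\<Sum>k\<in>I. X k \<omega>)"

lemma measurable_X [measurable]: "k \<in> I \<Longrightarrow> X k \<in> borel_measurable P"
  using indep by (simp add: indep_vars_def)

lemma measurable_Y [measurable]: "Y \<in> borel_measurable P"
  unfolding Y_def[abs_def] by measurable

lemma integrable_X:
  assumes "k \<in> I"
  shows "integrable P (X k)"
proof (rule integrable_const_bound)
  show "AE \<omega> in P. norm (X k \<omega>) \<le> (real CARD('n))\<^sup>2 * (real CARD('n) * L)"
    using spectrum[OF assms] AE_space
    by eventually_elim (auto intro: norm_le_of_lambda herm assms)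
qed (use assms in measurable)

lemma AE_pos_semidef_X:
  assumes "k \<in> I"
  shows "AE \<omega> in P. pos_semidef (X k \<omega>)"
  using spectrum[OF assms] AE_space
  by eventually_elim (auto intro: pos_semidef_of_lambda_min herm[OF assms])

lemma AE_pos_semidef_Y: "AE \<omega> in P. pos_semidef (Y \<omega>)"
proof -
  have "AE \<omega> in P. \<forall>k\<in>I. pos_semidef (X k \<omega>)"
    using fin AE_pos_semidef_X by (auto simp: AE_finite_all)
  then show ?thesis by eventually_elim (auto simp: Y_def intro: pos_semidef_sum)
qed

lemma expectation_Y: "expectation Y = (\<Sum>k\<in>I. expectation (X k))"
  unfolding Y_def[abs_def] by (rule Bochner_Integration.integral_sum) (rule integrable_X)

lemma pos_semidef_expectation_Y: "pos_semidef (expectation Y)"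
  unfolding expectation_Y
  by (intro pos_semidef_sum pos_semidef_expectation integrable_X herm AE_pos_semidef_X)

text \<open>The chord bound gives \<open>E (exp (\<theta> X\<^sub>k)) \<le> 1 + g (E X\<^sub>k) \<le> exp (g (E X\<^sub>k))\<close> in the semidefinite order, so
  \<open>W k = g (E X\<^sub>k)\<close> is admissible for each summand; these sum to \<open>g (E Y)\<close>, and the trace exponential is
  monotone.\<close>

lemma trace_mgf_bound:
  assumes L: "L > 0" and \<theta>: "\<theta> > 0" and B: "pos_semidef (B - expectation Y)" "hermitian B"
  defines "G \<equiv> \<lambda>\<omega>. rtr (mexp (\<theta> *\<^sub>R Y \<omega>))" and "g \<equiv> (exp (\<theta> * L) - 1) / L"
  shows "integrable P G" "expectation G \<le> rtr (mexp (g *\<^sub>R B))"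
proof -
  have g: "g \<ge> 0" using L \<theta> by (simp add: g_def)
  have [measurable]: "G \<in> borel_measurable P" unfolding G_def by measurable
  have herm_EX: "hermitian (expectation (X k))" if "k \<in> I" for k
    using that by (intro hermitian_expectation integrable_X herm)
  have bound: "AE \<omega> in P. pos_semidef ((\<theta> * L) *\<^sub>R mat 1 - \<theta> *\<^sub>R X k \<omega>)" if "k \<in> I" for k
    using spectrum[OF that] AE_space
  proof eventually_elim
    case (elim \<omega>)
    have "pos_semidef (\<theta> *\<^sub>R (L *\<^sub>R mat 1 - X k \<omega>))"
      using elim \<theta> that herm by (intro pos_semidef_scaleR pos_semidef_of_lambda_max) auto
    then show ?case by (simp add: algebra_simps)
  qed
  have dom: "pos_semidef (mexp (g *\<^sub>R expectation (X k)) - expectation (\<lambda>\<omega>. mexp (\<theta> *\<^sub>R X k \<omega>)))"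
    if k: "k \<in> I" for k
  proof -
    have herm': "hermitian (\<theta> *\<^sub>R X k \<omega>)" if "\<omega> \<in> space P" for \<omega>
      using herm[OF k that] by (rule hermitian_scaleR)
    have int: "integrable P (\<lambda>\<omega>. mexp (\<theta> *\<^sub>R X k \<omega>))"
      using integrable_mexp[OF _ herm' hermitian_zero bound[OF k]] k by simp
    have int': "integrable P (\<lambda>\<omega>. mat 1 + g *\<^sub>R X k \<omega>)"
      using integrable_X[OF k] by simp
    have "pos_semidef (expectation (\<lambda>\<omega>. mat 1 + g *\<^sub>R X k \<omega> - mexp (\<theta> *\<^sub>R X k \<omega>)))"
    proof (rule pos_semidef_expectation)
      show "AE \<omega> in P. pos_semidef (mat 1 + g *\<^sub>R X k \<omega> - mexp (\<theta> *\<^sub>R X k \<omega>))"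
        using spectrum[OF k] AE_space
        unfolding g_def by eventually_elim (use k L herm in \<open>auto intro: mexp_chord\<close>)
      show "hermitian (mat 1 + g *\<^sub>R X k \<omega> - mexp (\<theta> *\<^sub>R X k \<omega>))" if "\<omega> \<in> space P" for \<omega>
        by (intro hermitian_diff hermitian_add hermitian_one hermitian_scaleR hermitian_mexp herm k that)
    qed (intro Bochner_Integration.integrable_diff int int')
    also have "expectation (\<lambda>\<omega>. mat 1 + g *\<^sub>R X k \<omega> - mexp (\<theta> *\<^sub>R X k \<omega>))
        = mat 1 + g *\<^sub>R expectation (X k) - expectation (\<lambda>\<omega>. mexp (\<theta> *\<^sub>R X k \<omega>))"
      using integrable_X[OF k] by (simp add: Bochner_Integration.integral_diff[OF int' int] prob_space)
    finally have "pos_semidef (mat 1 + g *\<^sub>R expectation (X k) - expectation (\<lambda>\<omega>. mexp (\<theta> *\<^sub>R X k \<omega>)))" .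
    from pos_semidef_add[OF this one_plus_le_mexp[OF hermitian_scaleR[OF herm_EX[OF k], of g]]]
    show ?thesis by simp
  qed
  have nn: "(\<integral>\<^sup>+\<omega>. ennreal (G \<omega>) \<partial>P) \<le> ennreal (rtr (mexp (g *\<^sub>R expectation Y)))"
  proof -
    have "indep_vars (\<lambda>_. borel) (\<lambda>k \<omega>. \<theta> *\<^sub>R X k \<omega>) I"
      by (rule indep_vars_compose2[OF indep]) simp
    from nn_integral_rtr_mexp_sum_le[OF fin this hermitian_scaleR[OF herm] bound hermitian_scaleR[OF herm_EX] dom
        hermitian_zero]
    show ?thesis
      by (simp add: G_def Y_def expectation_Y scaleR_sum_right)
  qed
  have G_nonneg: "0 \<le> G \<omega>" if "\<omega> \<in> space P" for \<omega>
  proof -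
    have "pos_semidef (mexp (\<theta> *\<^sub>R Y \<omega>))"
      unfolding Y_def using that by (intro pos_semidef_mexp hermitian_scaleR hermitian_sum herm)
    then show ?thesis by (simp add: G_def rtr_nonneg)
  qed
  show int_G: "integrable P G"
  proof (rule integrableI_bounded)
    have "(\<integral>\<^sup>+\<omega>. ennreal (norm (G \<omega>)) \<partial>P) = (\<integral>\<^sup>+\<omega>. ennreal (G \<omega>) \<partial>P)"
      using G_nonneg by (intro nn_integral_cong) simp
    also have "\<dots> < \<infinity>" using nn by (rule order_le_less_trans) simp
    finally show "(\<integral>\<^sup>+\<omega>. ennreal (norm (G \<omega>)) \<partial>P) < \<infinity>" .
  qed measurable
  have mono: "rtr (mexp (g *\<^sub>R expectation Y)) \<le> rtr (mexp (g *\<^sub>R B))"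
    using pos_semidef_expectation_Y B g
    by (intro rtr_mexp_mono hermitian_scaleR)
       (auto simp: pos_semidef_def[of "expectation Y"] simp flip: scaleR_diff_right intro: pos_semidef_scaleR)
  have pos: "0 \<le> rtr (mexp (g *\<^sub>R expectation Y))"
    using pos_semidef_expectation_Y
    by (intro rtr_nonneg pos_semidef_mexp hermitian_scaleR) (simp add: pos_semidef_def)
  have "ennreal (expectation G) \<le> ennreal (rtr (mexp (g *\<^sub>R expectation Y)))"
    using nn nn_integral_eq_integral[OF int_G AE_I2[OF G_nonneg]] by simp
  then have "expectation G \<le> rtr (mexp (g *\<^sub>R expectation Y))"
    using pos by (simp add: ennreal_le_iff)
  with mono show "expectation G \<le> rtr (mexp (g *\<^sub>R B))" by linarith
qed

end

context bounded_matrix_family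
begin

context
  fixes B :: "complex^'n^'n"
  assumes herm_B: "hermitian B" and B_nonzero: "B \<noteq> 0" and B: "pos_semidef (B - expectation Y)"
begin

lemma pos_semidef_B: "pos_semidef B"
  using pos_semidef_add[OF B pos_semidef_expectation_Y] by simp

lemmas mu_pos = lambda_max_pos[OF pos_semidef_B B_nonzero]
  and d_ge_one = intdim_ge_one[OF pos_semidef_B B_nonzero]

text \<open>The dominating variable \<open>G\<close> is measurable by construction, which makes both tail and mean estimates
  independent of the measurability of \<open>lambda_max Y\<close>.\<close>

lemma exp_lambda_max_dominated:
  assumes L: "L > 0" and \<theta>: "\<theta> > 0"
  obtains G where "integrable P G" "AE \<omega> in P. exp (\<theta> * lambda_max (Y \<omega>)) \<le> G \<omega>"
    "expectation G \<le> intdim B * (exp ((exp (\<theta> * L) - 1) / L * lambda_max B) - 1) + 1"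
proof
  define G where "G \<omega> = rtr (mexp (\<theta> *\<^sub>R Y \<omega>)) - CARD('n) + 1" for \<omega>
  note mgf = trace_mgf_bound[OF L \<theta> B herm_B]
  show "integrable P G" unfolding G_def using mgf(1) by simp
  show "AE \<omega> in P. exp (\<theta> * lambda_max (Y \<omega>)) \<le> G \<omega>"
    using AE_pos_semidef_Y
    by eventually_elim (use exp_lambda_max_le(2)[OF _ \<theta>] in \<open>simp add: G_def\<close>)
  have "expectation G = expectation (\<lambda>\<omega>. rtr (mexp (\<theta> *\<^sub>R Y \<omega>))) - CARD('n) + 1"
    unfolding G_def using mgf(1) by (simp add: prob_space)
  also have "\<dots> \<le> rtr (mexp (((exp (\<theta> * L) - 1) / L) *\<^sub>R B)) - CARD('n) + 1"
    using mgf(2) by simp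
  also have "\<dots> \<le> intdim B * (exp ((exp (\<theta> * L) - 1) / L * lambda_max B) - 1) + 1"
    using rtr_mexp_le_intdim[OF pos_semidef_B B_nonzero, of "(exp (\<theta> * L) - 1) / L"] L \<theta> by simp
  finally show "expectation G \<le> intdim B * (exp ((exp (\<theta> * L) - 1) / L * lambda_max B) - 1) + 1" .
qed

lemma AE_Y_eq_0:
  assumes "L = 0"
  shows "AE \<omega> in P. Y \<omega> = 0"
proof -
  have "AE \<omega> in P. X k \<omega> = 0" if "k \<in> I" for k
    using spectrum[OF that] AE_space
    by eventually_elim (use norm_le_of_lambda[OF herm[OF that]] assms in force)
  then have "AE \<omega> in P. \<forall>k\<in>I. X k \<omega> = 0" using fin by (auto simp: AE_finite_all)
  then show ?thesis by eventually_elim (simp add: Y_def)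
qed

text \<open>Jensen's inequality for the logarithm, written as the tangent line bound
  \<open>x \<le> c - 1 + exp (x - c)\<close> with \<open>c\<close> the logarithm of the bound on the exponential moment. The
  exponential moment is taken at \<open>\<theta> / L\<close>. An integral of a function that is not integrable is \<open>0\<close>, and the
  right-hand side is nonnegative. For \<open>L = 0\<close> the matrix \<open>Y\<close> vanishes almost surely.\<close>

theorem expectation_lambda_max_le:
  assumes L: "L \<ge> 0" and \<theta>: "\<theta> > 0"
  shows "expectation (\<lambda>\<omega>. lambda_max (Y \<omega>))
    \<le> (exp \<theta> - 1) / \<theta> * lambda_max B + 1 / \<theta> * L * ln (2 * intdim B)" (is "_ \<le> ?rhs")
proof -
  have rhs_nonneg: "0 \<le> ?rhs"
    using L \<theta> mu_pos d_ge_one by (intro add_nonneg_nonneg mult_nonneg_nonneg) auto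
  consider "\<not> integrable P (\<lambda>\<omega>. lambda_max (Y \<omega>))"
    | "integrable P (\<lambda>\<omega>. lambda_max (Y \<omega>))" "L = 0"
    | "integrable P (\<lambda>\<omega>. lambda_max (Y \<omega>))" "L > 0"
    using L by linarith
  then show ?thesis
  proof cases
    case 1
    then show ?thesis using rhs_nonneg by (simp add: not_integrable_integral_eq)
  next
    case 2
    have "expectation (\<lambda>\<omega>. lambda_max (Y \<omega>)) \<le> expectation (\<lambda>_. 0)"
      using 2(1)
    proof (rule integral_mono_AE)
      show "AE \<omega> in P. lambda_max (Y \<omega>) \<le> 0"
        using AE_Y_eq_0[OF 2(2)] by eventually_elim (simp add: lambda_max_zero)
    qed simp
    with rhs_nonneg show ?thesis by simp
  next
    case 3
    let ?\<theta> = "\<theta> / L"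
    let ?b = "(exp \<theta> - 1) / L * lambda_max B"
    have "?\<theta> > 0" using 3 \<theta> by simp
    from exp_lambda_max_dominated[OF 3(2) this] obtain G
      where G: "integrable P G" "AE \<omega> in P. exp (?\<theta> * lambda_max (Y \<omega>)) \<le> G \<omega>"
        and EG1: "expectation G \<le> intdim B * (exp ?b - 1) + 1"
      using 3(2) by auto
    note EG1
    also have "intdim B * (exp ?b - 1) + 1 \<le> intdim B * exp ?b"
      using d_ge_one by (simp add: right_diff_distrib)
    also have "\<dots> \<le> 2 * intdim B * exp ?b" using d_ge_one by simp
    finally have EG: "expectation G \<le> 2 * intdim B * exp ?b" .
    define c where "c = ln (2 * intdim B) + ?b"
    have exp_c: "exp c = 2 * intdim B * exp ?b"
      using d_ge_one by (simp add: c_def exp_add)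
    have "expectation (\<lambda>\<omega>. ?\<theta> * lambda_max (Y \<omega>)) \<le> expectation (\<lambda>\<omega>. c - 1 + G \<omega> / exp c)"
    proof (rule integral_mono_AE)
      show "AE \<omega> in P. ?\<theta> * lambda_max (Y \<omega>) \<le> c - 1 + G \<omega> / exp c"
        using G(2)
      proof eventually_elim
        case (elim \<omega>)
        have "1 + (?\<theta> * lambda_max (Y \<omega>) - c) \<le> exp (?\<theta> * lambda_max (Y \<omega>) - c)"
          by (rule exp_ge_add_one_self)
        also have "\<dots> \<le> G \<omega> / exp c"
          using elim by (simp add: exp_diff divide_right_mono)
        finally show ?case by simp
      qed
    qed (use 3(1) G(1) in auto)
    also have "\<dots> = c - 1 + expectation G / exp c"
      using G(1) by (simp add: prob_space)
    also have "\<dots> \<le> c" using EG d_ge_one by (simp add: exp_c)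
    finally have "?\<theta> * expectation (\<lambda>\<omega>. lambda_max (Y \<omega>)) \<le> c" by simp
    then have "expectation (\<lambda>\<omega>. lambda_max (Y \<omega>)) \<le> c * L / \<theta>"
      using 3(2) \<theta> by (simp add: field_simps)
    also have "\<dots> = ?rhs" using 3(2) \<theta> by (simp add: c_def field_simps)
    finally show ?thesis .
  qed
qed

text \<open>Markov's inequality for \<open>exp (\<theta> lambda_max Y) - 1\<close> at the optimal \<open>\<theta> = ln (1 + \<epsilon>) / L\<close>, for which
  \<open>g = \<epsilon> / L\<close>. Subtracting \<open>1\<close> is what cancels the dimension of the matrices; it costs the factor \<open>2\<close>,
  because \<open>\<theta> t \<ge> 1\<close> at the level \<open>t = (1 + \<epsilon>) \<mu>\<close> when \<open>\<epsilon> \<ge> L / \<mu>\<close>, and then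
  \<open>exp (\<theta> t) - 1 \<ge> exp (\<theta> t) / 2\<close>. For \<open>L = 0\<close> the exponent \<open>lambda_max B / L\<close> is \<open>0\<close> by the convention
  for division, and the bound is at least \<open>1\<close>. A set that is not measurable has measure \<open>0\<close>.\<close>

theorem prob_lambda_max_ge_le:
  assumes L: "L \<ge> 0" and \<epsilon>: "\<epsilon> \<ge> L / lambda_max B"
  shows "measure P {\<omega> \<in> space P. lambda_max (Y \<omega>) \<ge> (1 + \<epsilon>) * lambda_max B}
    \<le> 2 * intdim B * (exp \<epsilon> / (1 + \<epsilon>) powr (1 + \<epsilon>)) powr (lambda_max B / L)"
    (is "measure P ?S \<le> ?rhs")
proof -
  define \<mu> where "\<mu> = lambda_max B"
  have \<mu>: "\<mu> > 0" using mu_pos by (simp add: \<mu>_def)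
  have "\<epsilon> \<ge> 0" using order_trans[OF _ \<epsilon>, of 0] L \<mu> by (simp add: \<mu>_def)
  consider "L = 0" | "L > 0" "?S \<notin> events" | "L > 0" "?S \<in> events" using L by linarith
  then show ?thesis
  proof cases
    case 1
    have "?rhs = 2 * intdim B" using 1 \<open>\<epsilon> \<ge> 0\<close> by simp
    with d_ge_one prob_le_1[of ?S] show ?thesis by linarith
  next
    case 2
    then show ?thesis using d_ge_one by (simp add: measure_notin_sets)
  next
    case 3
    define \<theta> where "\<theta> = ln (1 + \<epsilon>) / L"
    define t where "t = (1 + \<epsilon>) * \<mu>"
    have \<epsilon>_pos: "\<epsilon> > 0"
      using \<epsilon> 3(1) \<mu> by (intro order_less_le_trans[OF _ \<epsilon>]) (simp add: \<mu>_def)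
    have \<theta>: "\<theta> > 0" using \<epsilon>_pos 3(1) by (simp add: \<theta>_def)
    have \<theta>L: "exp (\<theta> * L) - 1 = \<epsilon>" using \<epsilon>_pos 3(1) by (simp add: \<theta>_def)
    have log_ge: "\<epsilon> \<le> (1 + \<epsilon>) * ln (1 + \<epsilon>)"
    proof -
      have "ln (1 / (1 + \<epsilon>)) \<le> 1 / (1 + \<epsilon>) - 1" using \<epsilon>_pos by (intro ln_le_minus_one) simp
      then show ?thesis using \<epsilon>_pos by (simp add: ln_div field_simps)
    qed
    have \<theta>t: "1 \<le> \<theta> * t"
    proof -
      have "1 \<le> \<epsilon> * (\<mu> / L)" using \<epsilon> 3(1) \<mu> by (simp add: \<mu>_def field_simps)
      also have "\<dots> \<le> (1 + \<epsilon>) * ln (1 + \<epsilon>) * (\<mu> / L)"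
        using log_ge 3(1) \<mu> by (intro mult_right_mono) auto
      also have "\<dots> = \<theta> * t" by (simp add: \<theta>_def t_def)
      finally show ?thesis .
    qed
    obtain G where G: "integrable P G" "AE \<omega> in P. exp (\<theta> * lambda_max (Y \<omega>)) \<le> G \<omega>"
      and EG: "expectation G \<le> intdim B * (exp (\<epsilon> / L * \<mu>) - 1) + 1"
      using exp_lambda_max_dominated[OF 3(1) \<theta>] unfolding \<theta>L \<mu>_def[symmetric] by metis
    have int_S: "integrable P (indicat_real ?S)"
      using 3(2) by (intro integrable_real_indicator) (simp_all add: emeasure_eq_measure)
    have "expectation (\<lambda>\<omega>. (exp (\<theta> * t) - 1) * indicator ?S \<omega>) \<le> expectation (\<lambda>\<omega>. G \<omega> - 1)"
    proof (rule integral_mono_AE)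
      show "AE \<omega> in P. (exp (\<theta> * t) - 1) * indicator ?S \<omega> \<le> G \<omega> - 1"
        using G(2) AE_pos_semidef_Y
      proof eventually_elim
        case (elim \<omega>)
        have "1 \<le> G \<omega>" using exp_lambda_max_le(1)[OF elim(2) \<theta>] elim(1) by linarith
        moreover have "exp (\<theta> * t) \<le> G \<omega>" if "\<omega> \<in> ?S"
        proof -
          have "exp (\<theta> * t) \<le> exp (\<theta> * lambda_max (Y \<omega>))"
            using that \<theta> by (simp add: t_def \<mu>_def)
          with elim(1) show ?thesis by linarith
        qed
        ultimately show ?case by (simp add: indicator_def)
      qed
    qed (use G(1) int_S in auto)
    then have "(exp (\<theta> * t) - 1) * measure P ?S \<le> expectation G - 1"
      using G(1) 3(2) by (simp add: prob_space)
    also have "\<dots> \<le> intdim B * exp (\<epsilon> / L * \<mu>)"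
      using EG d_ge_one by (simp add: algebra_simps)
    finally have Markov: "(exp (\<theta> * t) - 1) * measure P ?S \<le> intdim B * exp (\<epsilon> / L * \<mu>)" .
    have "exp (\<theta> * t) / 2 \<le> exp (\<theta> * t) - 1"
      using exp_ge_add_one_self[of "\<theta> * t"] \<theta>t by linarith
    then have "exp (\<theta> * t) / 2 * measure P ?S \<le> (exp (\<theta> * t) - 1) * measure P ?S"
      by (intro mult_right_mono) auto
    with Markov have "measure P ?S \<le> 2 * intdim B * (exp (\<epsilon> / L * \<mu>) / exp (\<theta> * t))"
      by (simp add: field_simps)
    also have "exp (\<epsilon> / L * \<mu>) / exp (\<theta> * t) = exp ((\<mu> / L) * (\<epsilon> - (1 + \<epsilon>) * ln (1 + \<epsilon>)))"
      by (simp add: \<theta>_def t_def algebra_simps diff_divide_distrib add_divide_distrib flip: exp_diff)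
    also have "\<dots> = (exp \<epsilon> / (1 + \<epsilon>) powr (1 + \<epsilon>)) powr (\<mu> / L)"
      using \<epsilon>_pos by (simp add: powr_def exp_diff[symmetric] ln_div)
    finally show ?thesis by (simp add: \<mu>_def)
  qed
qed

end

end

theorem theorem7p2p1:
  fixes P :: "'a measure" and I :: "'i set"
    and X :: "'i \<Rightarrow> 'a \<Rightarrow> complex^'n^'n" and Y :: "'a \<Rightarrow> complex^'n^'n"
    and M :: "complex^'n^'n" and L d \<mu>max :: real
  assumes "prob_space P"
    and "finite I"
    and "prob_space.indep_vars P (\<lambda>_. borel) X I"
    and "\<And>k \<omega>. k \<in> I \<Longrightarrow> \<omega> \<in> space P \<Longrightarrow> hermitian (X k \<omega>)"
    and "\<And>k. k \<in> I \<Longrightarrow> AE \<omega> in P. 0 \<le> lambda_min (X k \<omega>) \<and> lambda_max (X k \<omega>) \<le> L"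
    and "0 \<le> L"
    and "\<And>\<omega>. Y \<omega> = (\<Sum>k\<in>I. X k \<omega>)"
    and "hermitian M"
    and "M \<noteq> 0"
    and "loewner_le (prob_space.expectation P Y) M"
    and "d = intdim M"
    and "\<mu>max = lambda_max M"
  shows "(\<forall>\<theta>>0. prob_space.expectation P (\<lambda>\<omega>. lambda_max (Y \<omega>))
             \<le> (exp \<theta> - 1) / \<theta> * \<mu>max + 1 / \<theta> * L * ln (2 * d)) \<and>
         (\<forall>\<epsilon>\<ge>L / \<mu>max. measure P {\<omega> \<in> space P. lambda_max (Y \<omega>) \<ge> (1 + \<epsilon>) * \<mu>max}
             \<le> 2 * d * (exp \<epsilon> / (1 + \<epsilon>) powr (1 + \<epsilon>)) powr (\<mu>max / L))"
proof -
  interpret F: bounded_matrix_family P I X L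
    using assms(1-5) by (intro bounded_matrix_family.intro bounded_matrix_family_axioms.intro)
  have Y: "Y = F.Y" using assms(7) by (auto simp: F.Y_def)
  have M: "pos_semidef (M - F.expectation F.Y)" using assms(10) by (simp add: loewner_le_def Y)
  show ?thesis
    unfolding Y assms(11,12)
    using F.expectation_lambda_max_le[OF assms(8,9) M assms(6)]
      F.prob_lambda_max_ge_le[OF assms(8,9) M assms(6)] by blast
qed

end
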